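(* Let $F|k$ be a field extension with $F$ algebraically closed, and let $G_{F|k}=\mathrm{Aut}(F|k)$ with its compact-open topology. Then: (1) For every subfield $L$ with $k\subseteq L\subseteq F$, the group $\mathrm{Aut}(F|L)$ is a closed subgroup of $G_{F|k}$. For two such subfields $L_1,L_2$ one has $\mathrm{Aut}(F|L_1)=\mathrm{Aut}(F|L_2)$ if and only if $L_1^i=L_2^i$. Thus $L\mapsto\mathrm{Aut}(F|L)$ induces an injection from intermediate fields up to perfect equivalence into closed subgroups of $G_{F|k}$. (2) This map restricts to a bijection between intermediate fields $L$ with $\overline{L}=F$ (i.e. $F|L$ algebraic), up to perfect equivalence, and the compact subgroups of $G_{F|k}$. (3) It further restricts to a bijection between intermediate fields $L$ that are finitely generated over $k$ with $\overline{L}=F$, up to perfect equivalence, and the compact open subgroups of $G_{F|k}$.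
   Context: $G_{F|k}=\mathrm{Aut}(F|k)$ carries the compact-open topology for discrete $F$. A basis of open neighbourhoods of the identity is given by the subgroups $\mathrm{Aut}(F|K)$ with $K|k$ a finitely generated subextension of $F|k$. For a subfield $L\subseteq F$, its perfect closure $L^i$ is the set of elements of $F$ purely inseparable over $L$. Two subfields $L_1,L_2$ of $F$ are perfectly equivalent if $L_1^i=L_2^i$. *)

theory Defs
  imports "HOL-Analysis.Analysis" "HOL-Computational_Algebra.Polynomial"
begin

text \<open>The big field F is the whole type 'a (a field); subfields are subsets of it.\<close>

definition subfield :: "'a::field set \<Rightarrow> bool" where
  "subfield L \<longleftrightarrow> 0 \<in> L \<and> 1 \<in> L \<and>
     (\<forall>x\<in>L. \<forall>y\<in>L. x + y \<in> L \<and> x - y \<in> L \<and> x * y \<in> L) \<and>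
     (\<forall>x\<in>L. inverse x \<in> L)"

definition alg_closed_field :: "'a::field itself \<Rightarrow> bool" where
  "alg_closed_field _ \<longleftrightarrow> (\<forall>p :: 'a poly. degree p > 0 \<longrightarrow> (\<exists>x. poly p x = 0))"

definition Aut :: "'a::field set \<Rightarrow> ('a \<Rightarrow> 'a) set" where
  "Aut L = {\<sigma>. bij \<sigma> \<and> (\<forall>x y. \<sigma> (x + y) = \<sigma> x + \<sigma> y) \<and>
                 (\<forall>x y. \<sigma> (x * y) = \<sigma> x * \<sigma> y) \<and> \<sigma> 1 = 1 \<and>
                 (\<forall>x\<in>L. \<sigma> x = x)}"

text \<open>Compact-open topology on G_{F|k} for discrete F = topology of pointwise
  convergence = subspace of the product of discrete spaces.\<close>
definition Gal_top :: "'a::field set \<Rightarrow> ('a \<Rightarrow> 'a) topology" where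
  "Gal_top k = subtopology (product_topology (\<lambda>_. discrete_topology UNIV) UNIV) (Aut k)"

definition is_subgroup :: "('a \<Rightarrow> 'a) set \<Rightarrow> ('a \<Rightarrow> 'a) set \<Rightarrow> bool" where
  "is_subgroup H G \<longleftrightarrow> H \<subseteq> G \<and> id \<in> H \<and> (\<forall>\<sigma>\<in>H. \<forall>\<tau>\<in>H. \<sigma> \<circ> \<tau> \<in> H) \<and>
     (\<forall>\<sigma>\<in>H. inv \<sigma> \<in> H)"

definition purely_inseparable_over :: "'a::field set \<Rightarrow> 'a \<Rightarrow> bool" where
  "purely_inseparable_over L x \<longleftrightarrow>
     (if CHAR('a) = 0 then x \<in> L else (\<exists>n. x ^ (CHAR('a) ^ n) \<in> L))"

definition perfect_closure :: "'a::field set \<Rightarrow> 'a set" where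
  "perfect_closure L = {x. purely_inseparable_over L x}"

definition algebraic_over :: "'a::field set \<Rightarrow> 'a \<Rightarrow> bool" where
  "algebraic_over L x \<longleftrightarrow> (\<exists>p. p \<noteq> 0 \<and> (\<forall>i. coeff p i \<in> L) \<and> poly p x = 0)"

definition alg_dense :: "'a::field set \<Rightarrow> bool" where
  "alg_dense L \<longleftrightarrow> (\<forall>x. algebraic_over L x)"

definition field_generated :: "'a::field set \<Rightarrow> 'a set" where
  "field_generated S = \<Inter>{L. subfield L \<and> S \<subseteq> L}"

definition fin_gen_over :: "'a::field set \<Rightarrow> 'a set \<Rightarrow> bool" where
  "fin_gen_over k L \<longleftrightarrow> (\<exists>S. finite S \<and> L = field_generated (k \<union> S))"

end

theory Submission
  imports Defs
begin

text \<open>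
  Parts (1) and (3) rest on the equality of the fixed field of \<open>Aut(F|L)\<close> with \<open>L\<^sup>i\<close>. If \<open>x\<close> is not in
  \<open>L\<^sup>i\<close>, choose \<open>M \<supseteq> L\<close> maximal with \<open>x \<notin> M\<^sup>i\<close>; then \<open>F|M\<close> is algebraic. Indeed, for
  \<open>x\<close> transcendental over \<open>M\<close> the substitution \<open>x \<mapsto> -1 - x\<close> fixes \<open>x\<^sup>2 + x\<close>, so
  \<open>x \<notin> M(x\<^sup>2 + x)\<^sup>i\<close>, against maximality; and an algebraic \<open>x\<close> cannot lie in \<open>M(y)\<^sup>i\<close> for \<open>y\<close>
  transcendental over \<open>M\<close>. The minimal polynomial of \<open>x\<close> over \<open>M\<close> has a second root, and an
  isomorphism moving \<open>x\<close> there extends to \<open>F\<close>. No transcendence bases are needed.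

  A compact subgroup \<open>H\<close> has finite orbits, hence \<open>F\<close> is algebraic over its fixed field \<open>L\<close>, and \<open>H\<close> is
  closed and dense in \<open>Aut(F|L)\<close>. If \<open>H\<close> is also open, it contains \<open>Aut(F|k(S))\<close> for a finite \<open>S\<close>. The
  coefficients of the orbit polynomials of \<open>S\<close> generate a subfield \<open>L\<^sub>1 \<subseteq> L\<close> over which \<open>F\<close> is algebraic,
  and by compactness of \<open>Aut(F|L\<^sub>1) - H\<close> finitely many further elements of \<open>L\<close> cut out \<open>H\<close>.
\<close>

section \<open>Subfields and polynomials over them\<close>

lemma subfield_0: "subfield K \<Longrightarrow> 0 \<in> K"
  and subfield_1: "subfield K \<Longrightarrow> 1 \<in> K"
  and subfield_add: "subfield K \<Longrightarrow> x \<in> K \<Longrightarrow> y \<in> K \<Longrightarrow> x + y \<in> K"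
  and subfield_diff: "subfield K \<Longrightarrow> x \<in> K \<Longrightarrow> y \<in> K \<Longrightarrow> x - y \<in> K"
  and subfield_mult: "subfield K \<Longrightarrow> x \<in> K \<Longrightarrow> y \<in> K \<Longrightarrow> x * y \<in> K"
  and subfield_inverse: "subfield K \<Longrightarrow> x \<in> K \<Longrightarrow> inverse x \<in> K"
  by (auto simp: subfield_def)

lemma subfield_uminus: "subfield K \<Longrightarrow> x \<in> K \<Longrightarrow> - x \<in> K"
  using subfield_diff[of K 0 x] by (simp add: subfield_0)

lemma subfield_divide: "subfield K \<Longrightarrow> x \<in> K \<Longrightarrow> y \<in> K \<Longrightarrow> x / y \<in> K"
  by (simp add: divide_inverse subfield_mult subfield_inverse)

lemma subfield_power: "subfield K \<Longrightarrow> x \<in> K \<Longrightarrow> x ^ n \<in> K"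
  by (induction n) (auto simp: subfield_1 subfield_mult)

lemma subfield_sum: "subfield K \<Longrightarrow> (\<And>i. i \<in> I \<Longrightarrow> f i \<in> K) \<Longrightarrow> sum f I \<in> K"
  by (induction I rule: infinite_finite_induct) (auto simp: subfield_0 subfield_add)

lemma subfield_of_nat: "subfield K \<Longrightarrow> of_nat n \<in> K"
  by (induction n) (auto simp: subfield_0 subfield_1 subfield_add)

lemmas subfield_closed =
  subfield_0 subfield_1 subfield_add subfield_diff subfield_mult subfield_inverse
  subfield_uminus subfield_divide subfield_power subfield_of_nat

lemma subfield_field_generated: "subfield (field_generated S)"
  unfolding field_generated_def subfield_def by blast

lemma field_generated_superset: "S \<subseteq> field_generated S"
  unfolding field_generated_def by blast

lemma field_generated_least: "subfield L \<Longrightarrow> S \<subseteq> L \<Longrightarrow> field_generated S \<subseteq> L"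
  unfolding field_generated_def by blast

section \<open>Polynomials with coefficients in a subfield, and simple extensions\<close>

definition poly_over :: "'a::zero set \<Rightarrow> 'a poly set" where
  "poly_over K = {p. \<forall>i. coeff p i \<in> K}"

lemma poly_over_coeff: "p \<in> poly_over K \<Longrightarrow> coeff p i \<in> K"
  by (simp add: poly_over_def)

lemma algebraic_over_iff: "algebraic_over K x \<longleftrightarrow> (\<exists>p \<in> poly_over K. p \<noteq> 0 \<and> poly p x = 0)"
  unfolding algebraic_over_def poly_over_def by blast

lemma poly_over_mono: "K \<subseteq> L \<Longrightarrow> poly_over K \<subseteq> poly_over L"
  by (auto simp: poly_over_def)

lemma algebraic_over_mono: "K \<subseteq> L \<Longrightarrow> algebraic_over K x \<Longrightarrow> algebraic_over L x"
  unfolding algebraic_over_def by blast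

lemma alg_dense_mono: "K \<subseteq> L \<Longrightarrow> alg_dense K \<Longrightarrow> alg_dense L"
  unfolding alg_dense_def using algebraic_over_mono by blast

text \<open>This is \<open>K(y)\<close>, given by fractions rather than as an intersection of
  subfields, so that a member hands out a numerator and a denominator.\<close>

definition adjoin :: "'a::field set \<Rightarrow> 'a \<Rightarrow> 'a set" where
  "adjoin K y = {poly f y / poly g y | f g. f \<in> poly_over K \<and> g \<in> poly_over K \<and> poly g y \<noteq> 0}"

text \<open>The vectors serve as their own indices. When \<open>B\<close> is an image of a family of
  powers, coinciding powers collapse, which is harmless: only a finite bound on the number of
  vectors matters.\<close>

definition finite_span :: "'a::field set \<Rightarrow> 'a set \<Rightarrow> 'a set" where
  "finite_span K B = {\<Sum>b\<in>B. c b * b | c. \<forall>b\<in>B. c b \<in> K}"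

context
  fixes K :: "'a::field set"
  assumes K: "subfield K"
begin

lemma poly_over_pCons_iff: "pCons a p \<in> poly_over K \<longleftrightarrow> a \<in> K \<and> p \<in> poly_over K"
  unfolding poly_over_def by (force simp: coeff_pCons split: nat.splits)

lemma poly_over_0: "0 \<in> poly_over K"
  by (simp add: poly_over_def subfield_0[OF K])

lemma poly_over_1: "1 \<in> poly_over K"
  by (simp add: one_pCons poly_over_pCons_iff poly_over_0 subfield_1[OF K])

lemma poly_over_add: "p \<in> poly_over K \<Longrightarrow> q \<in> poly_over K \<Longrightarrow> p + q \<in> poly_over K"
  by (simp add: poly_over_def subfield_add[OF K])

lemma poly_over_diff: "p \<in> poly_over K \<Longrightarrow> q \<in> poly_over K \<Longrightarrow> p - q \<in> poly_over K"
  by (simp add: poly_over_def subfield_diff[OF K])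

lemma poly_over_smult: "a \<in> K \<Longrightarrow> p \<in> poly_over K \<Longrightarrow> smult a p \<in> poly_over K"
  by (simp add: poly_over_def subfield_mult[OF K])

lemma poly_over_mult: "p \<in> poly_over K \<Longrightarrow> q \<in> poly_over K \<Longrightarrow> p * q \<in> poly_over K"
  by (auto simp: poly_over_def coeff_mult intro!: subfield_sum[OF K] subfield_mult[OF K])

lemma poly_over_power: "p \<in> poly_over K \<Longrightarrow> p ^ n \<in> poly_over K"
  by (induction n) (auto simp: poly_over_1 poly_over_mult)

lemma poly_over_monom: "a \<in> K \<Longrightarrow> monom a n \<in> poly_over K"
  by (simp add: poly_over_def subfield_0[OF K])

lemma poly_over_pcompose: "p \<in> poly_over K \<Longrightarrow> q \<in> poly_over K \<Longrightarrow> pcompose p q \<in> poly_over K"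
  by (induction p)
     (auto simp: pcompose_pCons poly_over_pCons_iff poly_over_0 poly_over_add poly_over_mult)

text \<open>Long division by induction on the coefficients of \<open>f\<close>: the only division is
  by the leading coefficient of \<open>p\<close>, so everything stays in \<open>K\<close>.\<close>

lemma poly_over_division:
  assumes p: "p \<in> poly_over K" "p \<noteq> 0" and f: "f \<in> poly_over K"
  obtains q r where "q \<in> poly_over K" "r \<in> poly_over K" "f = q * p + r" "r = 0 \<or> degree r < degree p"
proof -
  have "\<exists>q \<in> poly_over K. \<exists>r \<in> poly_over K. f = q * p + r \<and> (r = 0 \<or> degree r < degree p)"
    using f
  proof (induction f)
    case 0
    show ?case by (intro bexI[of _ 0]) (auto simp: poly_over_0)
  next
    case (pCons a f)
    then obtain q r where qr: "q \<in> poly_over K" "r \<in> poly_over K" "f = q * p + r"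
      and deg: "r = 0 \<or> degree r < degree p" and a: "a \<in> K"
      by (auto simp: poly_over_pCons_iff)
    \<comment> \<open>The degree of \<open>pCons a r\<close> is at most \<open>degree p\<close>;
      this multiple of \<open>p\<close> cancels its coefficient there.\<close>
    define c where "c = coeff (pCons a r) (degree p) / lead_coeff p"
    have c: "c \<in> K"
      unfolding c_def using qr a p
      by (intro subfield_divide[OF K]) (auto intro: poly_over_coeff simp: poly_over_pCons_iff)
    define r' where "r' = pCons a r - smult c p"
    have eq: "pCons a f = (pCons 0 q + [:c:]) * p + r'"
      by (simp add: r'_def qr algebra_simps)
    have "degree (pCons a r) \<le> degree p"
      using deg by (auto simp: degree_pCons_eq_if)
    hence 1: "degree r' \<le> degree p"
      unfolding r'_def by (intro degree_diff_le) auto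
    have 2: "coeff r' (degree p) = 0"
      using p by (simp add: r'_def c_def)
    have "r' = 0 \<or> degree r' < degree p"
      using 1 2 by (metis leading_coeff_0_iff order_le_less)
    moreover have "pCons 0 q + [:c:] \<in> poly_over K" "r' \<in> poly_over K"
      using qr a c p unfolding r'_def
      by (auto simp: poly_over_pCons_iff poly_over_0 subfield_0[OF K]
               intro!: poly_over_add poly_over_diff poly_over_smult)
    ultimately show ?case using eq by blast
  qed
  thus ?thesis using that by blast
qed

text \<open>Take a nonzero annihilating polynomial of least degree and make it monic; remainders on
  division by it must vanish. Divisibility is recorded instead of irreducibility: the kernel of
  evaluation at \<open>y\<close> is generated by \<open>p\<close>.\<close>

lemma minimal_polynomial_exists:
  assumes "algebraic_over K y"
  obtains p where "p \<in> poly_over K" "lead_coeff p = 1" "poly p y = 0" "degree p > 0"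
    "\<And>f. f \<in> poly_over K \<Longrightarrow> poly f y = 0 \<Longrightarrow> \<exists>q \<in> poly_over K. f = q * p"
proof -
  define P where "P = (\<lambda>p. p \<in> poly_over K \<and> p \<noteq> 0 \<and> poly p y = 0)"
  obtain p0 where p0: "P p0" and min: "\<And>q. P q \<Longrightarrow> degree p0 \<le> degree q"
    using assms ex_has_least_nat[of P _ degree] unfolding P_def algebraic_over_iff by blast
  define p where "p = smult (inverse (lead_coeff p0)) p0"
  have p: "p \<in> poly_over K" "lead_coeff p = 1" "poly p y = 0" "degree p = degree p0"
    using p0 by (auto simp: p_def P_def intro!: poly_over_smult subfield_inverse[OF K] poly_over_coeff)
  have "degree p > 0"
  proof (rule ccontr)
    assume "\<not> degree p > 0"
    then obtain c where "p = [:c:]" using degree_eq_zeroE by blast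
    thus False using p by simp
  qed
  moreover have "\<exists>q \<in> poly_over K. f = q * p" if f: "f \<in> poly_over K" "poly f y = 0" for f
  proof -
    have "p \<noteq> 0" using p by auto
    from poly_over_division[OF p(1) this f(1)] obtain q r where
      qr: "q \<in> poly_over K" "r \<in> poly_over K" "f = q * p + r" "r = 0 \<or> degree r < degree p" by blast
    hence "poly r y = 0" using f p by simp
    with qr min[of r] p have "r = 0" unfolding P_def by (metis leD)
    with qr show ?thesis by auto
  qed
  ultimately show ?thesis using that p by blast
qed

lemma adjoinI:
  "f \<in> poly_over K \<Longrightarrow> g \<in> poly_over K \<Longrightarrow> poly g y \<noteq> 0 \<Longrightarrow> z = poly f y / poly g y \<Longrightarrow> z \<in> adjoin K y"
  unfolding adjoin_def by blast

lemma adjoin_poly: "f \<in> poly_over K \<Longrightarrow> poly f y \<in> adjoin K y"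
  by (rule adjoinI[of f 1]) (auto simp: poly_over_1)

lemma adjoin_superset: "K \<subseteq> adjoin K y"
  using adjoin_poly[of "[:_:]" y] by (auto simp: poly_over_pCons_iff poly_over_0)

lemma adjoin_self: "y \<in> adjoin K y"
  using adjoin_poly[of "[:0,1:]" y] by (auto simp: poly_over_pCons_iff poly_over_0 subfield_closed[OF K])

lemma subfield_adjoin: "subfield (adjoin K y)"
proof -
  have "u + v \<in> adjoin K y \<and> u - v \<in> adjoin K y \<and> u * v \<in> adjoin K y"
    if uv: "u \<in> adjoin K y" "v \<in> adjoin K y" for u v
  proof -
    obtain f g where u: "u = poly f y / poly g y" "f \<in> poly_over K" "g \<in> poly_over K" "poly g y \<noteq> 0"
      using uv unfolding adjoin_def by blast
    obtain f' g' where v: "v = poly f' y / poly g' y" "f' \<in> poly_over K" "g' \<in> poly_over K" "poly g' y \<noteq> 0"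
      using uv unfolding adjoin_def by blast
    have "u + v \<in> adjoin K y"
      using u v by (intro adjoinI[of "f * g' + f' * g" "g * g'"])
        (auto simp: add_frac_eq intro!: poly_over_add poly_over_mult)
    moreover have "u - v \<in> adjoin K y"
      using u v by (intro adjoinI[of "f * g' - f' * g" "g * g'"])
        (auto simp: diff_frac_eq intro!: poly_over_diff poly_over_mult)
    moreover have "u * v \<in> adjoin K y"
      using u v by (intro adjoinI[of "f * f'" "g * g'"]) (auto intro!: poly_over_mult)
    ultimately show ?thesis by blast
  qed
  moreover have "inverse u \<in> adjoin K y" if uv: "u \<in> adjoin K y" for u
  proof -
    obtain f g where u: "u = poly f y / poly g y" "f \<in> poly_over K" "g \<in> poly_over K" "poly g y \<noteq> 0"
      using uv unfolding adjoin_def by blast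
    show ?thesis
    proof (cases "poly f y = 0")
      case True
      thus ?thesis using u uv by simp
    next
      case False
      thus ?thesis using u by (intro adjoinI[of g f]) auto
    qed
  qed
  ultimately show ?thesis
    using adjoin_superset subfield_0[OF K] subfield_1[OF K] unfolding subfield_def by blast
qed

section \<open>Towers of algebraic extensions\<close>

text \<open>Gaussian elimination by induction on the number of equations. An equation with zero
  coefficients is dropped; otherwise one of its unknowns is eliminated, which lowers both counts by
  one.\<close>

lemma homogeneous_system_solution:
  fixes A :: "'i \<Rightarrow> 'j \<Rightarrow> 'a"
  assumes "finite J" "finite I" "card J < card I" "\<And>i j. i \<in> I \<Longrightarrow> j \<in> J \<Longrightarrow> A i j \<in> K"
  shows "\<exists>c. (\<forall>i\<in>I. c i \<in> K) \<and> (\<exists>i\<in>I. c i \<noteq> 0) \<and> (\<forall>j\<in>J. (\<Sum>i\<in>I. c i * A i j) = 0)"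
  using assms
proof (induction J arbitrary: I A rule: finite_induct)
  case empty
  hence "I \<noteq> {}" by auto
  thus ?case by (intro exI[of _ "\<lambda>_. 1"]) (auto simp: subfield_1[OF K])
next
  case (insert j J)
  show ?case
  proof (cases "\<forall>i\<in>I. A i j = 0")
    case True
    have "\<exists>c. (\<forall>i\<in>I. c i \<in> K) \<and> (\<exists>i\<in>I. c i \<noteq> 0) \<and> (\<forall>j\<in>J. (\<Sum>i\<in>I. c i * A i j) = 0)"
      using insert by (intro insert.IH) auto
    thus ?thesis using True by auto
  next
    case False
    then obtain i0 where i0: "i0 \<in> I" "A i0 j \<noteq> 0" by blast
    define I' where "I' = I - {i0}"
    have I': "finite I'" "I = insert i0 I'" "i0 \<notin> I'" using insert i0 by (auto simp: I'_def)
    \<comment> \<open>Equation \<open>j\<close> is solved for the unknown \<open>i0\<close> and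
      substituted into equation \<open>j'\<close>.\<close>
    define B where "B = (\<lambda>i j'. A i j' - A i j / A i0 j * A i0 j')"
    have "\<exists>c. (\<forall>i\<in>I'. c i \<in> K) \<and> (\<exists>i\<in>I'. c i \<noteq> 0) \<and> (\<forall>j\<in>J. (\<Sum>i\<in>I'. c i * B i j) = 0)"
    proof (rule insert.IH)
      show "card J < card I'" using insert I' by auto
      show "B i j' \<in> K" if "i \<in> I'" "j' \<in> J" for i j'
        unfolding B_def using that insert.prems I' by (intro subfield_closed[OF K]) auto
    qed (use I' in auto)
    then obtain c where c: "\<And>i. i\<in>I' \<Longrightarrow> c i \<in> K" "\<exists>i\<in>I'. c i \<noteq> 0"
      "\<And>j. j\<in>J \<Longrightarrow> (\<Sum>i\<in>I'. c i * B i j) = 0" by blast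
    define s where "s = (\<Sum>i\<in>I'. c i * A i j)"
    define d where "d = c(i0 := - s / A i0 j)"
    have sumd: "(\<Sum>i\<in>I. d i * A i j') = (\<Sum>i\<in>I'. c i * A i j') - s / A i0 j * A i0 j'" for j'
    proof -
      have "(\<Sum>i\<in>I'. d i * A i j') = (\<Sum>i\<in>I'. c i * A i j')"
        using I' by (intro sum.cong) (auto simp: d_def)
      thus ?thesis using I' by (simp add: d_def)
    qed
    have "(\<Sum>i\<in>I. d i * A i j') = 0" if "j' \<in> insert j J" for j'
    proof (cases "j' = j")
      case True
      thus ?thesis using i0 by (simp add: sumd s_def)
    next
      case False
      have "0 = (\<Sum>i\<in>I'. c i * B i j')" using c(3)[of j'] False that by simp
      also have "\<dots> = (\<Sum>i\<in>I'. c i * A i j') - s / A i0 j * A i0 j'"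
        by (simp add: B_def s_def right_diff_distrib sum_subtractf sum_divide_distrib sum_distrib_right mult.assoc)
      finally show ?thesis by (simp add: sumd)
    qed
    moreover have "d i \<in> K" if "i \<in> I" for i
    proof (cases "i = i0")
      case True
      have "s \<in> K" unfolding s_def using c insert.prems I'
        by (intro subfield_sum[OF K] subfield_mult[OF K]) auto
      thus ?thesis using True insert.prems i0 by (auto simp: d_def intro!: subfield_closed[OF K])
    next
      case False
      thus ?thesis using that c I' by (auto simp: d_def)
    qed
    moreover have "\<exists>i\<in>I. d i \<noteq> 0" using c(2) I' by (auto simp: d_def)
    ultimately show ?thesis by blast
  qed
qed

lemma finite_span_add: "u \<in> finite_span K B \<Longrightarrow> v \<in> finite_span K B \<Longrightarrow> u + v \<in> finite_span K B"
proof -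
  assume "u \<in> finite_span K B" "v \<in> finite_span K B"
  then obtain c d where "u = (\<Sum>b\<in>B. c b * b)" "\<forall>b\<in>B. c b \<in> K" "v = (\<Sum>b\<in>B. d b * b)" "\<forall>b\<in>B. d b \<in> K"
    unfolding finite_span_def by blast
  thus ?thesis unfolding finite_span_def
    by (auto intro!: exI[of _ "\<lambda>b. c b + d b"] simp: sum.distrib distrib_right subfield_add[OF K])
qed

lemma finite_span_scale: "a \<in> K \<Longrightarrow> v \<in> finite_span K B \<Longrightarrow> a * v \<in> finite_span K B"
proof -
  assume a: "a \<in> K" and "v \<in> finite_span K B"
  then obtain d where "v = (\<Sum>b\<in>B. d b * b)" "\<forall>b\<in>B. d b \<in> K"
    unfolding finite_span_def by blast
  thus ?thesis unfolding finite_span_def using a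
    by (auto intro!: exI[of _ "\<lambda>b. a * d b"] simp: sum_distrib_left mult.assoc subfield_mult[OF K])
qed

lemma finite_span_0: "0 \<in> finite_span K B"
  unfolding finite_span_def by (auto intro!: exI[of _ "\<lambda>b. 0"] simp: subfield_0[OF K])

lemma finite_span_sum: "(\<And>i. i \<in> I \<Longrightarrow> f i \<in> finite_span K B) \<Longrightarrow> sum f I \<in> finite_span K B"
  by (induction I rule: infinite_finite_induct) (auto simp: finite_span_0 finite_span_add)

lemma finite_span_superset: "finite B \<Longrightarrow> b \<in> B \<Longrightarrow> b \<in> finite_span K B"
  unfolding finite_span_def
  by (auto intro!: exI[of _ "\<lambda>b'. if b' = b then 1 else 0"]
           simp: subfield_0[OF K] subfield_1[OF K] if_distrib[of "\<lambda>u. u * _"] cong: if_cong)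

lemma finite_span_mult_closed:
  assumes "\<And>b. b \<in> B \<Longrightarrow> z * b \<in> finite_span K B" and "v \<in> finite_span K B"
  shows "z * v \<in> finite_span K B"
proof -
  obtain c where c: "v = (\<Sum>b\<in>B. c b * b)" "\<forall>b\<in>B. c b \<in> K"
    using assms unfolding finite_span_def by blast
  have "z * v = (\<Sum>b\<in>B. c b * (z * b))"
    unfolding c by (simp add: sum_distrib_left mult_ac)
  also have "\<dots> \<in> finite_span K B"
    using c assms(1) by (intro finite_span_sum finite_span_scale[of "c _"]) auto
  finally show ?thesis .
qed

text \<open>The \<open>card B + 1\<close> powers from \<open>1\<close> to \<open>z ^ card B\<close>
  have coordinates indexed by \<open>B\<close>, so some nontrivial combination of them has all
  coordinates zero.\<close>

lemma algebraic_over_if_powers_in_finite_span: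
  assumes "finite B" and pow: "\<And>t. z ^ t \<in> finite_span K B"
  shows "algebraic_over K z"
proof -
  have "\<forall>t. \<exists>c. z ^ t = (\<Sum>b\<in>B. c b * b) \<and> (\<forall>b\<in>B. c b \<in> K)"
    using pow unfolding finite_span_def by blast
  then obtain A where A: "\<And>t. z ^ t = (\<Sum>b\<in>B. A t b * b)" "\<And>t b. b \<in> B \<Longrightarrow> A t b \<in> K" by metis
  have "\<exists>c. (\<forall>i\<in>{..card B}. c i \<in> K) \<and> (\<exists>i\<in>{..card B}. c i \<noteq> 0) \<and>
      (\<forall>b\<in>B. (\<Sum>i\<le>card B. c i * A i b) = 0)"
    using A(2) assms(1) by (intro homogeneous_system_solution) auto
  then obtain c where c: "\<And>i. i \<le> card B \<Longrightarrow> c i \<in> K" "\<exists>i\<le>card B. c i \<noteq> 0"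
    "\<And>b. b \<in> B \<Longrightarrow> (\<Sum>i\<le>card B. c i * A i b) = 0"
    unfolding Ball_def Bex_def atMost_iff by blast
  define p where "p = (\<Sum>i\<le>card B. monom (c i) i)"
  have coeff: "coeff p i = (if i \<le> card B then c i else 0)" for i
    by (simp add: p_def coeff_sum)
  have "poly p z = (\<Sum>i\<le>card B. c i * z ^ i)"
    by (simp add: p_def poly_sum poly_monom)
  also have "\<dots> = (\<Sum>i\<le>card B. \<Sum>b\<in>B. c i * A i b * b)"
    by (subst A) (simp add: sum_distrib_left mult.assoc)
  also have "\<dots> = (\<Sum>b\<in>B. (\<Sum>i\<le>card B. c i * A i b) * b)"
    by (subst sum.swap) (simp add: sum_distrib_right)
  also have "\<dots> = 0" using c by simp
  finally have "poly p z = 0" .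
  moreover have "p \<noteq> 0" using c(2) coeff by (metis coeff_0)
  moreover have "p \<in> poly_over K"
    using c(1) by (auto simp: poly_over_def coeff subfield_0[OF K])
  ultimately show ?thesis unfolding algebraic_over_iff by blast
qed

text \<open>Write the minimal polynomial of \<open>a\<close> as \<open>c + X q\<close>. Here
  \<open>c\<close> is nonzero, since otherwise \<open>q\<close> would annihilate \<open>a\<close> in
  smaller degree; hence \<open>inverse a\<close> is \<open>- q(a) / c\<close>.\<close>

lemma inverse_eq_poly:
  assumes "algebraic_over K a" "a \<noteq> 0"
  shows "\<exists>h \<in> poly_over K. inverse a = poly h a"
proof -
  obtain p where p: "p \<in> poly_over K" "lead_coeff p = 1" "poly p a = 0"
    "\<And>f. f \<in> poly_over K \<Longrightarrow> poly f a = 0 \<Longrightarrow> \<exists>q \<in> poly_over K. f = q * p"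
    using minimal_polynomial_exists[OF assms(1)] by metis
  obtain c q where cq: "p = pCons c q" by (cases p)
  have mem: "c \<in> K" "q \<in> poly_over K" using p cq by (auto simp: poly_over_pCons_iff)
  have eq: "c + a * poly q a = 0" using p cq by simp
  have "c \<noteq> 0"
  proof
    assume "c = 0"
    with eq assms have "poly q a = 0" by simp
    with p(4) mem obtain r where "q = r * p" by blast
    moreover have "q \<noteq> 0" using cq \<open>c = 0\<close> p by auto
    ultimately have "degree q \<ge> degree p"
      by (metis degree_mult_right_le mult.commute mult_eq_0_iff)
    thus False using cq \<open>q \<noteq> 0\<close> by simp
  qed
  have "inverse a = poly (smult (- inverse c) q) a"
    using eq \<open>c \<noteq> 0\<close> assms(2) by (simp add: field_simps eq_neg_iff_add_eq_0)
  moreover have "smult (- inverse c) q \<in> poly_over K"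
    using mem by (intro poly_over_smult subfield_uminus[OF K] subfield_inverse[OF K])
  ultimately show ?thesis by blast
qed

text \<open>The values \<open>poly f x\<close> lie in the span of finitely many powers of
  \<open>x\<close>. So do all powers of the denominator \<open>poly g x\<close>, which is therefore
  algebraic and has an inverse polynomial in itself.\<close>

lemma adjoin_algebraic_eq_poly:
  assumes x: "algebraic_over K x" and z: "z \<in> adjoin K x"
  shows "\<exists>f \<in> poly_over K. z = poly f x"
proof -
  obtain p where p: "p \<in> poly_over K" "lead_coeff p = 1" "poly p x = 0"
    using minimal_polynomial_exists[OF x] by metis
  have "p \<noteq> 0" using p by auto
  define B where "B = (\<lambda>i. x ^ i) ` {..<degree p}"
  have span: "poly f x \<in> finite_span K B" if f: "f \<in> poly_over K" for f
  proof -
    obtain q r where qr: "q \<in> poly_over K" "r \<in> poly_over K" "f = q * p + r" "r = 0 \<or> degree r < degree p"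
      using poly_over_division[OF p(1) \<open>p \<noteq> 0\<close> f] by metis
    show ?thesis
    proof (cases "r = 0")
      case True
      thus ?thesis using qr p by (simp add: finite_span_0)
    next
      case False
      have "poly f x = poly r x" using qr p by simp
      also have "\<dots> \<in> finite_span K B" unfolding poly_altdef using qr False
        by (intro finite_span_sum finite_span_scale finite_span_superset)
           (auto simp: B_def intro: poly_over_coeff)
      finally show ?thesis .
    qed
  qed
  obtain f g where fg: "z = poly f x / poly g x" "f \<in> poly_over K" "g \<in> poly_over K" "poly g x \<noteq> 0"
    using z unfolding adjoin_def by blast
  have "algebraic_over K (poly g x)"
    using span[OF poly_over_power[OF fg(3)]]
    by (intro algebraic_over_if_powers_in_finite_span[of B]) (auto simp: B_def poly_power)
  then obtain h where h: "h \<in> poly_over K" "inverse (poly g x) = poly h (poly g x)"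
    using inverse_eq_poly fg by blast
  show ?thesis
    using fg h by (intro bexI[of _ "f * pcompose h g"])
      (auto simp: divide_inverse poly_pcompose intro!: poly_over_mult poly_over_pcompose)
qed

text \<open>The products \<open>x ^ i * y ^ j\<close> below the two degrees span a space stable
  under multiplication by \<open>y\<close>, so it contains all powers of \<open>y\<close>.\<close>

lemma algebraic_over_adjoin_trans:
  assumes x: "algebraic_over K x" and y: "algebraic_over (adjoin K x) y"
  shows "algebraic_over K y"
proof -
  obtain p where p: "p \<in> poly_over K" "lead_coeff p = 1" "poly p x = 0"
    using minimal_polynomial_exists[OF x] by metis
  have "p \<noteq> 0" using p by auto
  obtain g0 where g0: "g0 \<in> poly_over (adjoin K x)" "g0 \<noteq> 0" "poly g0 y = 0"
    using y unfolding algebraic_over_iff by blast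
  define m where "m = degree g0"
  define a where "a = (\<lambda>j. - coeff g0 j / lead_coeff g0)"
  have a: "a j \<in> adjoin K x" for j
    unfolding a_def using g0
    by (intro subfield_divide subfield_uminus subfield_adjoin) (auto intro: poly_over_coeff)
  have ym: "y ^ m = (\<Sum>j<m. a j * y ^ j)"
  proof -
    have "0 = (\<Sum>j\<le>m. coeff g0 j * y ^ j)" using g0 by (simp add: poly_altdef m_def)
    also have "\<dots> = (\<Sum>j<m. coeff g0 j * y ^ j) + lead_coeff g0 * y ^ m"
      by (simp add: m_def lessThan_Suc_atMost[symmetric])
    finally have "lead_coeff g0 * y ^ m = - (\<Sum>j<m. coeff g0 j * y ^ j)"
      by (metis add.commute add_eq_0_iff2)
    hence "y ^ m = - (\<Sum>j<m. coeff g0 j * y ^ j) / lead_coeff g0"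
      using g0 by (simp add: field_simps)
    thus ?thesis by (simp add: a_def sum_divide_distrib sum_negf)
  qed
  \<comment> \<open>This puts \<open>1 = y ^ 0\<close> into the span, where the induction on powers
    starts.\<close>
  have "m > 0"
  proof (rule ccontr)
    assume "\<not> m > 0"
    with ym show False by simp
  qed
  define B where "B = (\<lambda>(i,j). x ^ i * y ^ j) ` ({..<degree p} \<times> {..<m})"
  have fin: "finite B" by (simp add: B_def)
  have span: "poly f x * y ^ j \<in> finite_span K B" if f: "f \<in> poly_over K" and j: "j < m" for f j
  proof -
    obtain q r where qr: "q \<in> poly_over K" "r \<in> poly_over K" "f = q * p + r" "r = 0 \<or> degree r < degree p"
      using poly_over_division[OF p(1) \<open>p \<noteq> 0\<close> f] by metis
    show ?thesis
    proof (cases "r = 0")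
      case True
      thus ?thesis using qr p by (simp add: finite_span_0)
    next
      case False
      have "poly f x * y ^ j = (\<Sum>i\<le>degree r. coeff r i * (x ^ i * y ^ j))"
        using qr p by (simp add: poly_altdef[of r] sum_distrib_right mult.assoc)
      also have "\<dots> \<in> finite_span K B" using qr False j
        by (intro finite_span_sum finite_span_scale finite_span_superset fin)
           (auto simp: B_def intro: poly_over_coeff)
      finally show ?thesis .
    qed
  qed
  have ad: "z * y ^ j \<in> finite_span K B" if "z \<in> adjoin K x" "j < m" for z j
    using adjoin_algebraic_eq_poly[OF x that(1)] span that by blast
  have "y * b \<in> finite_span K B" if "b \<in> B" for b
  proof -
    obtain i j where b: "b = x ^ i * y ^ j" "j < m" using \<open>b \<in> B\<close> by (auto simp: B_def)
    have xi: "x ^ i \<in> adjoin K x" by (intro subfield_power subfield_adjoin adjoin_self)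
    show ?thesis
    proof (cases "Suc j < m")
      case True
      thus ?thesis using ad[OF xi True] by (simp add: b mult_ac)
    next
      case False
      \<comment> \<open>Multiplication by \<open>y\<close> leaves the range of exponents here, and
        \<open>ym\<close> brings \<open>y ^ m\<close> back to lower powers.\<close>
      hence "Suc j = m" using b by simp
      hence "y * b = x ^ i * y ^ m" by (auto simp: b mult_ac)
      also have "\<dots> = (\<Sum>j<m. x ^ i * a j * y ^ j)" by (simp add: ym sum_distrib_left mult.assoc)
      also have "\<dots> \<in> finite_span K B"
        by (intro finite_span_sum ad subfield_mult subfield_adjoin xi a) auto
      finally show ?thesis .
    qed
  qed
  hence step: "y * v \<in> finite_span K B" if "v \<in> finite_span K B" for v
    using finite_span_mult_closed that by blast
  have "y ^ t \<in> finite_span K B" for t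
  proof (induction t)
    case 0
    show ?case using span[OF poly_over_1, of 0] \<open>m > 0\<close> by simp
  next
    case (Suc t)
    thus ?case using step[of "y ^ t"] by simp
  qed
  thus ?thesis using algebraic_over_if_powers_in_finite_span[OF fin] by blast
qed

end

lemma algebraic_over_field_generated_trans:
  assumes "subfield K" "finite S" "\<And>s. s \<in> S \<Longrightarrow> algebraic_over K s"
    and "algebraic_over (field_generated (K \<union> S)) z"
  shows "algebraic_over K z"
  using assms(2-4)
proof (induction S arbitrary: z rule: finite_induct)
  case empty
  have "field_generated (K \<union> {}) \<subseteq> K" using assms by (intro field_generated_least) auto
  thus ?case using empty algebraic_over_mono by blast
next
  case (insert s S)
  let ?E = "field_generated (K \<union> S)"
  have E: "subfield ?E" by (rule subfield_field_generated)
  have "field_generated (K \<union> insert s S) \<subseteq> adjoin ?E s"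
    using adjoin_superset[OF E, of s] adjoin_self[OF E, of s] field_generated_superset[of "K \<union> S"]
    by (intro field_generated_least subfield_adjoin[OF E]) auto
  hence "algebraic_over (adjoin ?E s) z" using insert.prems algebraic_over_mono by blast
  moreover have "algebraic_over ?E s"
    using insert.prems field_generated_superset[of "K \<union> S"] algebraic_over_mono[of K ?E s] by auto
  ultimately have "algebraic_over ?E z" using algebraic_over_adjoin_trans[OF E] by blast
  thus ?case using insert by blast
qed

section \<open>Extending homomorphisms\<close>

text \<open>Closure of the domain is part of the predicate, and values outside \<open>K\<close> are
  arbitrary. The types are rings, so that besides maps of subfields it covers
  \<open>map_poly f\<close> on polynomials.\<close>

definition ring_hom_on :: "'a::comm_ring_1 set \<Rightarrow> ('a \<Rightarrow> 'b::comm_ring_1) \<Rightarrow> bool" where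
  "ring_hom_on K \<sigma> \<longleftrightarrow> 1 \<in> K \<and> \<sigma> 1 = 1 \<and>
     (\<forall>x\<in>K. \<forall>y\<in>K. x + y \<in> K \<and> x - y \<in> K \<and> x * y \<in> K \<and>
        \<sigma> (x + y) = \<sigma> x + \<sigma> y \<and> \<sigma> (x * y) = \<sigma> x * \<sigma> y)"

context
  fixes K and \<sigma> :: "'a::comm_ring_1 \<Rightarrow> 'b::comm_ring_1"
  assumes hom: "ring_hom_on K \<sigma>"
begin

lemma ring_hom_on_zero_mem: "0 \<in> K"
  using hom unfolding ring_hom_on_def by (metis diff_self)

lemma ring_hom_on_add: "x \<in> K \<Longrightarrow> y \<in> K \<Longrightarrow> \<sigma> (x + y) = \<sigma> x + \<sigma> y"
  and ring_hom_on_mult: "x \<in> K \<Longrightarrow> y \<in> K \<Longrightarrow> \<sigma> (x * y) = \<sigma> x * \<sigma> y"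
  and ring_hom_on_one: "\<sigma> 1 = 1"
  and ring_hom_on_add_mem: "x \<in> K \<Longrightarrow> y \<in> K \<Longrightarrow> x + y \<in> K"
  and ring_hom_on_diff_mem: "x \<in> K \<Longrightarrow> y \<in> K \<Longrightarrow> x - y \<in> K"
  and ring_hom_on_mult_mem: "x \<in> K \<Longrightarrow> y \<in> K \<Longrightarrow> x * y \<in> K"
  using hom unfolding ring_hom_on_def by auto

lemma ring_hom_on_zero: "\<sigma> 0 = 0"
  using ring_hom_on_add[OF ring_hom_on_zero_mem ring_hom_on_zero_mem] by simp

lemma ring_hom_on_diff: "x \<in> K \<Longrightarrow> y \<in> K \<Longrightarrow> \<sigma> (x - y) = \<sigma> x - \<sigma> y"
  using ring_hom_on_add[of "x - y" y] by (simp add: ring_hom_on_diff_mem)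

lemma ring_hom_on_uminus: "x \<in> K \<Longrightarrow> \<sigma> (- x) = - \<sigma> x"
  using ring_hom_on_diff[of 0 x] by (simp add: ring_hom_on_zero ring_hom_on_zero_mem)

lemma ring_hom_on_sum:
  "(\<And>i. i \<in> I \<Longrightarrow> f i \<in> K) \<Longrightarrow> sum f I \<in> K \<and> \<sigma> (sum f I) = (\<Sum>i\<in>I. \<sigma> (f i))"
  by (induction I rule: infinite_finite_induct)
     (auto simp: ring_hom_on_zero ring_hom_on_zero_mem ring_hom_on_add ring_hom_on_add_mem)

lemma map_poly_hom_add:
  "p \<in> poly_over K \<Longrightarrow> q \<in> poly_over K \<Longrightarrow> map_poly \<sigma> (p + q) = map_poly \<sigma> p + map_poly \<sigma> q"
  by (intro poly_eqI) (auto simp: coeff_map_poly ring_hom_on_zero ring_hom_on_add poly_over_def)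

lemma map_poly_hom_diff:
  "p \<in> poly_over K \<Longrightarrow> q \<in> poly_over K \<Longrightarrow> map_poly \<sigma> (p - q) = map_poly \<sigma> p - map_poly \<sigma> q"
  by (intro poly_eqI) (auto simp: coeff_map_poly ring_hom_on_zero ring_hom_on_diff poly_over_def)

lemma map_poly_hom_mult:
  assumes "p \<in> poly_over K" "q \<in> poly_over K"
  shows "map_poly \<sigma> (p * q) = map_poly \<sigma> p * map_poly \<sigma> q"
proof (intro poly_eqI)
  fix n
  have mem: "coeff p i \<in> K" "coeff q i \<in> K" for i using assms by (auto simp: poly_over_def)
  have "\<sigma> (\<Sum>i\<le>n. coeff p i * coeff q (n - i)) = (\<Sum>i\<le>n. \<sigma> (coeff p i * coeff q (n - i)))"
    using ring_hom_on_sum[of "{..n}" "\<lambda>i. coeff p i * coeff q (n - i)"] mem ring_hom_on_mult_mem by blast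
  thus "coeff (map_poly \<sigma> (p * q)) n = coeff (map_poly \<sigma> p * map_poly \<sigma> q) n"
    by (simp add: coeff_map_poly ring_hom_on_zero coeff_mult ring_hom_on_mult mem)
qed

end

section \<open>Endomorphisms and automorphisms of the whole field\<close>

lemma ring_hom_on_UNIV_iff:
  "ring_hom_on UNIV f \<longleftrightarrow> f 1 = 1 \<and> (\<forall>x y. f (x + y) = f x + f y) \<and> (\<forall>x y. f (x * y) = f x * f y)"
  unfolding ring_hom_on_def by auto

lemma ring_hom_on_map_poly: "ring_hom_on UNIV f \<Longrightarrow> ring_hom_on UNIV (map_poly f)"
  by (simp add: ring_hom_on_UNIV_iff[of "map_poly f"] map_poly_hom_add map_poly_hom_mult ring_hom_on_one poly_over_def)

lemma poly_map_poly_hom: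
  assumes "ring_hom_on UNIV f"
  shows "poly (map_poly f p) (f x) = f (poly p x)"
  by (induction p)
     (simp_all add: map_poly_pCons ring_hom_on_zero[OF assms] ring_hom_on_add[OF assms]
        ring_hom_on_mult[OF assms])

lemma ring_hom_on_power: "ring_hom_on UNIV f \<Longrightarrow> f (x ^ n) = f x ^ n"
  by (induction n) (simp_all add: ring_hom_on_UNIV_iff)

lemma ring_hom_on_inverse:
  fixes f :: "'a::field \<Rightarrow> 'b::field"
  assumes "ring_hom_on UNIV f"
  shows "f (inverse x) = inverse (f x)"
proof (cases "x = 0")
  case True
  thus ?thesis using ring_hom_on_zero[OF assms] by simp
next
  case False
  hence "f (inverse x) * f x = 1"
    using ring_hom_on_mult[OF assms, of "inverse x" x] ring_hom_on_one[OF assms] by simp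
  thus ?thesis by (metis inverse_unique mult.commute)
qed

lemma ring_hom_on_inj:
  fixes f :: "'a::field \<Rightarrow> 'b::field"
  assumes "ring_hom_on UNIV f"
  shows "inj f"
proof (rule injI, rule ccontr)
  fix x y assume "f x = f y" "x \<noteq> y"
  hence "f ((x - y) * inverse (x - y)) = 0"
    by (simp only: ring_hom_on_mult[OF assms] ring_hom_on_diff[OF assms] UNIV_I) simp
  thus False using \<open>x \<noteq> y\<close> ring_hom_on_one[OF assms] by simp
qed

lemma Aut_iff: "\<sigma> \<in> Aut L \<longleftrightarrow> bij \<sigma> \<and> ring_hom_on UNIV \<sigma> \<and> (\<forall>x\<in>L. \<sigma> x = x)"
  unfolding Aut_def ring_hom_on_UNIV_iff by auto

text \<open>Surjectivity is at stake. A polynomial over \<open>M\<close> with root \<open>y\<close>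
  is fixed by \<open>\<sigma>\<close>, so the injective map \<open>\<sigma>\<close> sends its finite
  root set into itself, hence onto it.\<close>

lemma hom_fixing_alg_dense_in_Aut:
  fixes M :: "'a::field set"
  assumes "alg_dense M" and hom: "ring_hom_on UNIV \<sigma>" and fixed: "\<And>x. x \<in> M \<Longrightarrow> \<sigma> x = x"
  shows "\<sigma> \<in> Aut M"
proof -
  have inj: "inj \<sigma>" using ring_hom_on_inj[OF hom] .
  have "y \<in> range \<sigma>" for y
  proof -
    obtain p where p: "p \<noteq> 0" "p \<in> poly_over M" "poly p y = 0"
      using assms unfolding alg_dense_def algebraic_over_iff by blast
    define Z where "Z = {x. poly p x = 0}"
    have "map_poly \<sigma> p = p"
      using p fixed ring_hom_on_zero[OF hom] by (intro poly_eqI) (auto simp: coeff_map_poly poly_over_def)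
    hence "\<sigma> ` Z \<subseteq> Z"
      using poly_map_poly_hom[OF hom, of p] ring_hom_on_zero[OF hom] by (auto simp: Z_def)
    moreover have "finite Z" using p by (simp add: Z_def poly_roots_finite)
    ultimately have "\<sigma> ` Z = Z" using inj
      by (meson endo_inj_surj inj_on_subset subset_UNIV)
    thus ?thesis using p by (auto simp: Z_def)
  qed
  thus ?thesis using inj hom fixed by (auto simp: Aut_iff bij_def)
qed

text \<open>The candidate for an extension of \<open>\<sigma>\<close> to \<open>K[y]\<close> that
  sends \<open>y\<close> to \<open>y'\<close>. It is a relation because \<open>f\<close> is not
  determined by \<open>poly f y\<close>; single-valuedness is proved afterwards.\<close>

definition extension_graph :: "'a::field set \<Rightarrow> ('a \<Rightarrow> 'a) \<Rightarrow> 'a \<Rightarrow> 'a \<Rightarrow> ('a \<times> 'a) set" where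
  "extension_graph K \<sigma> y y' = {(poly f y, poly (map_poly \<sigma> f) y') | f. f \<in> poly_over K}"

text \<open>Graphs of ring homomorphisms defined on subrings. Single-valuedness is asked only at
  \<open>0\<close>; closure under differences carries it everywhere. As sets they are ordered by
  inclusion, ready for Zorn's lemma.\<close>

definition hom_graph :: "('a::field \<times> 'a) set \<Rightarrow> bool" where
  "hom_graph R \<longleftrightarrow> (1, 1) \<in> R \<and> (\<forall>b. (0, b) \<in> R \<longrightarrow> b = 0) \<and>
     (\<forall>a b c d. (a, b) \<in> R \<longrightarrow> (c, d) \<in> R \<longrightarrow>
        (a + c, b + d) \<in> R \<and> (a - c, b - d) \<in> R \<and> (a * c, b * d) \<in> R)"

lemma hom_graph_functional:
  assumes "hom_graph R" "(a, b) \<in> R" "(a, c) \<in> R"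
  shows "b = c"
proof -
  have "(a - a, b - c) \<in> R" using assms unfolding hom_graph_def by blast
  hence "b - c = 0" using assms(1) unfolding hom_graph_def by (metis diff_self)
  thus ?thesis by simp
qed

text \<open>Here \<open>p\<close> plays the minimal polynomial of \<open>y\<close>: if
  \<open>f\<close> vanishes at \<open>y\<close>, then \<open>f = q * p\<close>, and applying
  \<open>\<sigma>\<close> to the coefficients turns \<open>p\<close> into a polynomial that vanishes
  at \<open>y'\<close>. So \<open>0\<close> is related only to \<open>0\<close>.\<close>

lemma extension_graph_props:
  assumes K: "subfield K" and hom: "ring_hom_on K \<sigma>"
    and p: "p \<in> poly_over K" "\<And>f. f \<in> poly_over K \<Longrightarrow> poly f y = 0 \<Longrightarrow> \<exists>q \<in> poly_over K. f = q * p"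
    and y': "poly (map_poly \<sigma> p) y' = 0"
  shows "hom_graph (extension_graph K \<sigma> y y')"
    and "a \<in> K \<Longrightarrow> (a, \<sigma> a) \<in> extension_graph K \<sigma> y y'"
    and "(y, y') \<in> extension_graph K \<sigma> y y'"
proof -
  let ?E = "extension_graph K \<sigma> y y'"
  have E: "f \<in> poly_over K \<Longrightarrow> u = poly f y \<Longrightarrow> v = poly (map_poly \<sigma> f) y' \<Longrightarrow> (u, v) \<in> ?E" for f u v
    unfolding extension_graph_def by blast
  have s: "\<sigma> 0 = 0" "\<sigma> 1 = 1" using ring_hom_on_zero[OF hom] ring_hom_on_one[OF hom] by auto
  show const: "(a, \<sigma> a) \<in> ?E" if "a \<in> K" for a
    using that by (intro E[of "[:a:]"]) (auto simp: poly_over_pCons_iff[OF K] poly_over_0[OF K] map_poly_pCons s)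
  show "(y, y') \<in> ?E"
    by (intro E[of "[:0,1:]"]) (auto simp: poly_over_pCons_iff[OF K] poly_over_0[OF K] subfield_closed[OF K] map_poly_pCons s)
  show "hom_graph ?E" unfolding hom_graph_def
  proof (intro conjI allI impI)
    show "(1, 1) \<in> ?E" using const[of 1] s subfield_1[OF K] by simp
    show "b = 0" if "(0, b) \<in> ?E" for b
    proof -
      from that obtain f where f: "f \<in> poly_over K" "poly f y = 0" "b = poly (map_poly \<sigma> f) y'"
        unfolding extension_graph_def by auto
      with p obtain q where "q \<in> poly_over K" "f = q * p" by blast
      thus ?thesis using f y' p map_poly_hom_mult[OF hom, of q p] by simp
    qed
  next
    fix a b c d assume "(a, b) \<in> ?E" "(c, d) \<in> ?E"
    then obtain f g where f: "f \<in> poly_over K" "a = poly f y" "b = poly (map_poly \<sigma> f) y'"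
      and g: "g \<in> poly_over K" "c = poly g y" "d = poly (map_poly \<sigma> g) y'"
      unfolding extension_graph_def by auto
    show "(a + c, b + d) \<in> ?E"
      using f g by (intro E[of "f + g"]) (auto simp: map_poly_hom_add[OF hom] poly_over_add[OF K])
    show "(a - c, b - d) \<in> ?E"
      using f g by (intro E[of "f - g"]) (auto simp: map_poly_hom_diff[OF hom] poly_over_diff[OF K])
    show "(a * c, b * d) \<in> ?E"
      using f g by (intro E[of "f * g"]) (auto simp: map_poly_hom_mult[OF hom] poly_over_mult[OF K])
  qed
qed

lemma hom_graph_Union_chain:
  assumes "subset.chain A C" "C \<noteq> {}" "\<And>R. R \<in> A \<Longrightarrow> hom_graph R"
  shows "hom_graph (\<Union>C)"
proof -
  have C: "hom_graph R" if "R \<in> C" for R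
    using assms that unfolding subset.chain_def by blast
  have "\<exists>T\<in>C. u \<in> T \<and> v \<in> T" if "u \<in> \<Union>C" "v \<in> \<Union>C" for u v
    using that assms(1) unfolding subset_chain_def by blast
  hence "(a + c, b + d) \<in> \<Union>C \<and> (a - c, b - d) \<in> \<Union>C \<and> (a * c, b * d) \<in> \<Union>C"
    if "(a, b) \<in> \<Union>C" "(c, d) \<in> \<Union>C" for a b c d
    using that C unfolding hom_graph_def by (meson UnionI)
  moreover have "(1, 1) \<in> \<Union>C" using assms(2) C unfolding hom_graph_def by blast
  moreover have "b = 0" if "(0, b) \<in> \<Union>C" for b using that C unfolding hom_graph_def by blast
  ultimately show ?thesis unfolding hom_graph_def by blast
qed

text \<open>This is used to get inverses: a graph is closed under ring operations only, but the
  inverse of a nonzero element algebraic over \<open>M\<close> is a polynomial in it.\<close>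

lemma hom_graph_poly:
  assumes "hom_graph R" "\<And>m. m \<in> M \<Longrightarrow> (m, m) \<in> R" "subfield M" "(a, b) \<in> R" "h \<in> poly_over M"
  shows "(poly h a, poly h b) \<in> R"
  using assms(5)
proof (induction h)
  case 0
  thus ?case using assms subfield_0 by auto
next
  case (pCons c h)
  hence "(poly h a, poly h b) \<in> R" "(c, c) \<in> R" using assms by (auto simp: poly_over_pCons_iff)
  moreover have "(u + a * v, u' + b * v') \<in> R" if "(u, u') \<in> R" "(v, v') \<in> R" for u u' v v'
    using assms(1,4) that unfolding hom_graph_def by meson
  ultimately show ?case unfolding poly_pCons by blast
qed

text \<open>Zorn's lemma on graphs that contain the diagonal of \<open>M\<close> and
  \<open>(x, x')\<close>. If the domain of a maximal graph missed some \<open>y\<close>, mapping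
  \<open>y\<close> to a root of its transported minimal polynomial would enlarge the graph.\<close>

lemma Aut_maps_to_conjugate:
  fixes M :: "'a::field set"
  assumes closed: "alg_closed_field TYPE('a)" and M: "subfield M" and dense: "alg_dense M"
    and p: "p \<in> poly_over M" "\<And>f. f \<in> poly_over M \<Longrightarrow> poly f x = 0 \<Longrightarrow> \<exists>q \<in> poly_over M. f = q * p"
    and x': "poly p x' = 0"
  shows "\<exists>\<sigma> \<in> Aut M. \<sigma> x = x'"
proof -
  define \<A> where "\<A> = {R. hom_graph R \<and> (\<forall>m\<in>M. (m, m) \<in> R) \<and> (x, x') \<in> R}"
  have "ring_hom_on M id" unfolding ring_hom_on_def by (auto simp: subfield_closed[OF M])
  from extension_graph_props[OF M this p] x' have "extension_graph M id x x' \<in> \<A>"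
    unfolding \<A>_def by force
  moreover have "\<Union>C \<in> \<A>" if C: "C \<noteq> {}" "subset.chain \<A> C" for C
  proof -
    have "hom_graph (\<Union>C)" using C by (intro hom_graph_Union_chain[OF C(2)]) (auto simp: \<A>_def)
    moreover obtain R where "R \<in> C" "R \<in> \<A>" using C unfolding subset.chain_def by blast
    ultimately show ?thesis unfolding \<A>_def by blast
  qed
  ultimately obtain R where R: "R \<in> \<A>" and max: "\<And>T. T \<in> \<A> \<Longrightarrow> R \<subseteq> T \<Longrightarrow> T = R"
    using subset_Zorn_nonempty[of \<A>] by blast
  have graph: "hom_graph R" and diag: "\<And>m. m \<in> M \<Longrightarrow> (m, m) \<in> R" and xx': "(x, x') \<in> R"
    using R by (auto simp: \<A>_def)
  note functional = hom_graph_functional[OF graph]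
  define K where "K = Domain R"
  define \<sigma> where "\<sigma> a = (THE b. (a, b) \<in> R)" for a
  have \<sigma>_eq: "\<sigma> a = b" if "(a, b) \<in> R" for a b
    unfolding \<sigma>_def using that functional by (intro the_equality) auto
  have \<sigma>: "(a, \<sigma> a) \<in> R" if "a \<in> K" for a
    using that \<sigma>_eq unfolding K_def by auto
  have ops: "(a + c, b + d) \<in> R" "(a - c, b - d) \<in> R" "(a * c, b * d) \<in> R" if "(a, b) \<in> R" "(c, d) \<in> R" for a b c d
    using graph that unfolding hom_graph_def by blast+
  have "inverse a \<in> K" if "a \<in> K" for a
  proof (cases "a = 0")
    case False
    then obtain h where "h \<in> poly_over M" "inverse a = poly h a"
      using inverse_eq_poly[OF M] dense unfolding alg_dense_def by blast
    thus ?thesis using hom_graph_poly[OF graph diag M \<sigma>[OF that]] unfolding K_def by auto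
  qed (use that in auto)
  moreover have MK: "M \<subseteq> K" using diag unfolding K_def by blast
  moreover have closed_ops: "a + c \<in> K \<and> a - c \<in> K \<and> a * c \<in> K" if "a \<in> K" "c \<in> K" for a c
    using ops[OF \<sigma>[OF that(1)] \<sigma>[OF that(2)]] unfolding K_def by blast
  ultimately have K: "subfield K"
    using subfield_0[OF M] subfield_1[OF M] unfolding subfield_def by blast
  have "\<sigma> (a + c) = \<sigma> a + \<sigma> c \<and> \<sigma> (a * c) = \<sigma> a * \<sigma> c" if "a \<in> K" "c \<in> K" for a c
    using ops[OF \<sigma>[OF that(1)] \<sigma>[OF that(2)]] \<sigma>_eq by blast
  hence hom: "ring_hom_on K \<sigma>"
    using \<sigma>_eq[OF diag[OF subfield_1[OF M]]] closed_ops subfield_1[OF K] unfolding ring_hom_on_def by blast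
  have "y \<in> K" for y
  proof -
    have "algebraic_over K y" using dense MK algebraic_over_mono unfolding alg_dense_def by blast
    from minimal_polynomial_exists[OF K this] obtain r where r: "r \<in> poly_over K" "lead_coeff r = 1" "degree r > 0"
      "\<And>f. f \<in> poly_over K \<Longrightarrow> poly f y = 0 \<Longrightarrow> \<exists>q \<in> poly_over K. f = q * r" by metis
    \<comment> \<open>The degree survives since \<open>r\<close> is monic and
      \<open>\<sigma> 1 = 1\<close>; so the transported polynomial has a root.\<close>
    have "degree (map_poly \<sigma> r) = degree r"
      using r ring_hom_on_one[OF hom] by (intro map_poly_degree_eq) auto
    then obtain y' where "poly (map_poly \<sigma> r) y' = 0"
      using closed r unfolding alg_closed_field_def by metis
    note E = extension_graph_props[OF K hom r(1) r(4) this]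
    have sub: "R \<subseteq> extension_graph K \<sigma> y y'"
      using E(2) \<sigma>_eq unfolding K_def by (auto simp: Domain_iff)
    hence "extension_graph K \<sigma> y y' \<in> \<A>" using E(1) diag xx' unfolding \<A>_def by blast
    hence "extension_graph K \<sigma> y y' = R" using max sub by blast
    thus ?thesis using E(3) unfolding K_def by blast
  qed
  hence "K = UNIV" by blast
  hence "\<sigma> \<in> Aut M" using hom_fixing_alg_dense_in_Aut[OF dense] hom \<sigma>_eq diag by blast
  thus ?thesis using \<sigma>_eq xx' by blast
qed

section \<open>Perfect closures\<close>

text \<open>The exponents \<open>q\<close> of purely inseparable elements: powers of the characteristic, read as \<open>1\<close>
  in characteristic zero.\<close>

definition char_exp :: "'a::field itself \<Rightarrow> nat \<Rightarrow> nat" where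
  "char_exp _ n = (if CHAR('a) = 0 then 1 else CHAR('a) ^ n)"

lemma perfect_closure_iff: "x \<in> perfect_closure L \<longleftrightarrow> (\<exists>n. x ^ char_exp TYPE('a::field) n \<in> L)"
  for x :: "'a::field"
  unfolding perfect_closure_def purely_inseparable_over_def char_exp_def by simp

lemma char_exp_pos: "char_exp TYPE('a::field) n > 0"
  by (simp add: char_exp_def)

lemma char_exp_add: "char_exp TYPE('a::field) (m + n) = char_exp TYPE('a) m * char_exp TYPE('a) n"
  by (simp add: char_exp_def power_add)

text \<open>The exponent is \<open>1\<close> or a power of the prime characteristic, so this is
  additivity of the iterated Frobenius map.\<close>

lemma add_power_char_exp:
  fixes x y :: "'a::field"
  shows "(x + y) ^ char_exp TYPE('a) n = x ^ char_exp TYPE('a) n + y ^ char_exp TYPE('a) n"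
  using prime_CHAR_semidom[where ?'a = 'a] freshmans_dream'[where ?'a = 'a, of _ n x y]
  by (auto simp: char_exp_def)

lemma power_char_exp_inj:
  fixes x y :: "'a::field"
  assumes "x ^ char_exp TYPE('a) n = y ^ char_exp TYPE('a) n"
  shows "x = y"
proof -
  have "x ^ char_exp TYPE('a) n = (x - y) ^ char_exp TYPE('a) n + y ^ char_exp TYPE('a) n"
    using add_power_char_exp[of "x - y" y n] by simp
  hence "(x - y) ^ char_exp TYPE('a) n = 0" using assms by simp
  thus ?thesis by simp
qed

lemma sum_power_char_exp:
  fixes f :: "'i \<Rightarrow> 'a::field"
  shows "(\<Sum>i\<in>I. f i) ^ char_exp TYPE('a) n = (\<Sum>i\<in>I. f i ^ char_exp TYPE('a) n)"
  by (induction I rule: infinite_finite_induct)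
     (simp_all add: add_power_char_exp zero_power char_exp_pos)

lemma perfect_closure_superset: "L \<subseteq> perfect_closure L"
  unfolding perfect_closure_iff subset_iff by (auto simp: char_exp_def intro!: exI[of _ 0])

lemma perfect_closure_char_power:
  fixes x :: "'a::field"
  assumes "CHAR('a) > 0" "x ^ CHAR('a) \<in> perfect_closure L"
  shows "x \<in> perfect_closure L"
proof -
  obtain n where "(x ^ CHAR('a)) ^ char_exp TYPE('a) n \<in> L" using assms perfect_closure_iff by blast
  hence "x ^ char_exp TYPE('a) (Suc n) \<in> L"
    using assms by (simp add: char_exp_def power_mult[symmetric])
  thus ?thesis using perfect_closure_iff by blast
qed

lemma Aut_fixes_perfect_closure:
  assumes "\<sigma> \<in> Aut L" "x \<in> perfect_closure L"
  shows "\<sigma> x = x"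
proof -
  obtain n where "x ^ char_exp TYPE('a) n \<in> L" using assms perfect_closure_iff by blast
  hence "\<sigma> x ^ char_exp TYPE('a) n = x ^ char_exp TYPE('a) n"
    using assms(1) ring_hom_on_power[of \<sigma> x] unfolding Aut_iff by metis
  thus ?thesis by (rule power_char_exp_inj)
qed

text \<open>One exponent \<open>q\<close> moves all coefficients of \<open>p\<close> into
  \<open>L\<close>, and raising \<open>poly p y = 0\<close> to the power \<open>q\<close> gives an
  equation over \<open>L\<close> for \<open>y\<close>.\<close>

lemma algebraic_over_perfect_closure:
  fixes L :: "'a::field set"
  assumes L: "subfield L" and "algebraic_over (perfect_closure L) y"
  shows "algebraic_over L y"
proof -
  obtain p where p: "p \<in> poly_over (perfect_closure L)" "p \<noteq> 0" "poly p y = 0"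
    using assms unfolding algebraic_over_iff by blast
  have "\<exists>n. coeff p i ^ char_exp TYPE('a) n \<in> L" for i
    using p(1) perfect_closure_iff unfolding poly_over_def by blast
  then obtain e where e: "\<And>i. coeff p i ^ char_exp TYPE('a) (e i) \<in> L" by metis
  \<comment> \<open>The sum dominates every \<open>e i\<close> with \<open>i \<le> degree p\<close>,
    and \<open>L\<close> is closed under further powers, so \<open>N\<close> works for all
    coefficients at once.\<close>
  define N where "N = (\<Sum>i\<le>degree p. e i)"
  let ?q = "char_exp TYPE('a) N"
  have mem: "coeff p i ^ ?q \<in> L" for i
  proof (cases "i \<le> degree p")
    case True
    hence "e i \<le> N" unfolding N_def by (intro member_le_sum) auto
    then obtain d where "N = e i + d" using le_Suc_ex by blast
    thus ?thesis using e[of i] by (simp add: char_exp_add power_mult subfield_power[OF L])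
  next
    case False
    thus ?thesis by (simp add: coeff_eq_0 zero_power char_exp_pos subfield_0[OF L])
  qed
  define r where "r = (\<Sum>i\<le>degree p. monom (coeff p i ^ ?q) (i * ?q))"
  have "poly r y = (\<Sum>i\<le>degree p. coeff p i * y ^ i) ^ ?q"
    by (simp add: r_def poly_sum poly_monom sum_power_char_exp power_mult_distrib power_mult)
  hence "poly r y = 0" using p by (simp add: poly_altdef zero_power char_exp_pos)
  moreover have "r \<in> poly_over L"
    unfolding r_def poly_over_def
    by (auto simp: coeff_sum intro!: subfield_sum[OF L] mem subfield_0[OF L])
  \<comment> \<open>The exponents \<open>i * ?q\<close> are distinct because \<open>?q > 0\<close>,
    so the top term is not cancelled.\<close>
  moreover have "coeff r (degree p * ?q) = lead_coeff p ^ ?q"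
  proof -
    have "coeff r (degree p * ?q) = (\<Sum>i\<le>degree p. if i = degree p then coeff p i ^ ?q else 0)"
      unfolding r_def coeff_sum using char_exp_pos[where ?'a = 'a, of N] by (intro sum.cong) auto
    thus ?thesis by simp
  qed
  hence "r \<noteq> 0" using p by auto
  ultimately show ?thesis unfolding algebraic_over_iff by blast
qed

section \<open>Elements outside the perfect closure are moved by some automorphism\<close>

lemma coeff_pcompose_monom_mult:
  fixes p :: "'a::comm_ring_1 poly"
  assumes "n > 0"
  shows "coeff (pcompose p (monom 1 n)) (n * i) = coeff p i"
proof (induction p arbitrary: i)
  case 0
  show ?case by simp
next
  case (pCons a p)
  show ?case
  proof (cases i)
    case 0
    thus ?thesis using assms by (simp add: pcompose_pCons coeff_monom_mult)
  next
    case (Suc j)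
    hence "n * i - n = n * j" "n \<le> n * i" "n * i \<noteq> 0" using assms by auto
    have "coeff [:a:] (n * i) = 0" using \<open>n * i \<noteq> 0\<close> by (cases "n * i") auto
    with \<open>n \<le> n * i\<close> \<open>n * i - n = n * j\<close> show ?thesis using pCons.IH[of j] Suc
      by (simp add: pcompose_pCons coeff_monom_mult)
  qed
qed

lemma pcompose_power: "pcompose (p ^ n) r = pcompose p r ^ n"
  for p :: "'a::comm_ring_1 poly"
  by (induction n) (simp_all add: pcompose_1 pcompose_mult)

text \<open>Induction on \<open>n\<close>. If \<open>n\<close> is nonzero in the field, the
  coefficient \<open>- n x\<close> below the leading one puts \<open>x\<close> into
  \<open>M\<close>. Otherwise \<open>n = c * m\<close> for the characteristic \<open>c\<close>, and
  \<open>(T - x)^n = (T^c - x^c)^m\<close> reduces the claim to \<open>x ^ c\<close> and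
  \<open>m\<close>.\<close>

lemma purely_inseparable_if_linear_power_over:
  fixes x :: "'a::field"
  assumes M: "subfield M" and "n > 0" "[:- x, 1:] ^ n \<in> poly_over M"
  shows "x \<in> perfect_closure M"
  using assms(2,3)
proof (induction n arbitrary: x rule: less_induct)
  case (less n)
  show ?case
  proof (cases "of_nat n = (0 :: 'a)")
    case False
    obtain m where m: "n = Suc m" using less.prems by (cases n) auto
    have "coeff ([:- x, 1:] ^ n) m = - (of_nat n * x)"
      using coeff_linear_poly_power[of m n "- x" 1] m by simp
    hence "- (of_nat n * x) \<in> M" using less.prems poly_over_coeff by metis
    hence "- (- (of_nat n * x)) / of_nat n \<in> M" 
      by (intro subfield_divide[OF M] subfield_of_nat[OF M]) (rule subfield_uminus[OF M])
    hence "x \<in> M" using False by simp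
    thus ?thesis using perfect_closure_superset by blast
  next
    case True
    define c where "c = CHAR('a)"
    obtain m where m: "n = c * m" using True unfolding of_nat_eq_0_iff_char_dvd c_def by blast
    \<comment> \<open>Characteristic zero is excluded here: \<open>c = 0\<close> would force
      \<open>n = 0\<close>.\<close>
    have c: "c > 0" using m less.prems by auto
    have prime: "prime c" using prime_CHAR_semidom[where ?'a = 'a] c unfolding c_def by simp
    have "[:- x, 1:] ^ c = (monom 1 1 + [:- x:]) ^ CHAR('a poly)"
      by (simp add: c_def monom_altdef)
    also have "\<dots> = monom 1 1 ^ CHAR('a poly) + [:- x:] ^ CHAR('a poly)"
      using prime by (intro freshmans_dream) (auto simp: c_def)
    also have "\<dots> = monom 1 c + [:(- x) ^ c:]"
      by (simp add: c_def monom_power poly_const_pow)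
    \<comment> \<open>Expanding \<open>(- x + x) ^ c\<close> by additivity settles the sign for odd
      \<open>c\<close> and for \<open>c = 2\<close> alike.\<close>
    also have "(- x) ^ c = - (x ^ c)"
    proof -
      have "(- x + x) ^ c = (- x) ^ c + x ^ c"
        unfolding c_def using prime c_def by (intro freshmans_dream) auto
      thus ?thesis using c by (simp add: zero_power eq_neg_iff_add_eq_0)
    qed
    finally have "[:- x, 1:] ^ c = pcompose [:- (x ^ c), 1:] (monom 1 c)"
      by (simp add: pcompose_pCons)
    hence "[:- x, 1:] ^ n = pcompose ([:- (x ^ c), 1:] ^ m) (monom 1 c)"
      by (simp add: m power_mult pcompose_power)
    \<comment> \<open>Substituting \<open>T^c\<close> for \<open>T\<close> only spreads the
      coefficients out, so they can be read off from those known to lie in \<open>M\<close>.\<close>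
    hence "coeff ([:- (x ^ c), 1:] ^ m) i = coeff ([:- x, 1:] ^ n) (c * i)" for i
      using coeff_pcompose_monom_mult[OF c] by metis
    hence "[:- (x ^ c), 1:] ^ m \<in> poly_over M"
      using less.prems by (auto simp: poly_over_def)
    moreover have "m < n" "m > 0" using m less.prems prime prime_gt_1_nat by auto
    ultimately have "x ^ c \<in> perfect_closure M" using less.IH by blast
    thus ?thesis using perfect_closure_char_power c c_def by blast
  qed
qed

text \<open>Split off all factors \<open>T - x\<close>. A root of the cofactor would be a root of
  \<open>p\<close>, hence \<open>x\<close>, which is already divided out; so the cofactor is
  constant, and it is \<open>1\<close> because \<open>p\<close> is monic.\<close>

lemma monic_single_root_eq_linear_power:
  fixes p :: "'a::field poly"
  assumes "alg_closed_field TYPE('a)" "lead_coeff p = 1" "\<And>z. poly p z = 0 \<Longrightarrow> z = x"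
  shows "p = [:- x, 1:] ^ degree p"
proof -
  have "p \<noteq> 0" using assms by auto
  then obtain q where q: "p = [:- x, 1:] ^ order x p * q" "\<not> [:- x, 1:] dvd q"
    using order_decomp by blast
  have "poly q z \<noteq> 0" for z
    using assms(3)[of z] q poly_eq_0_iff_dvd[of q x] by (metis mult_zero_right poly_mult)
  hence "degree q = 0" using assms(1) unfolding alg_closed_field_def by blast
  then obtain c where c: "q = [:c:]" using degree_eq_zeroE by blast
  have "lead_coeff p = c" 
    using lead_coeff_mult[of "[:- x, 1:] ^ order x p" q] lead_coeff_power[of "[:- x, 1:]" "order x p"]
    unfolding q(1)[symmetric] by (simp add: c)
  hence "q = 1" using c assms by simp
  hence "p = [:- x, 1:] ^ order x p" using q by simp
  moreover from this have "degree p = order x p" by (metis degree_linear_power)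
  ultimately show ?thesis by simp
qed

text \<open>Were \<open>x\<close> the only root of its minimal polynomial, that polynomial would be
  a power of \<open>T - x\<close>, and \<open>x\<close> would be purely inseparable over
  \<open>M\<close>.\<close>

lemma alg_dense_moving_automorphism:
  fixes M :: "'a::field set"
  assumes closed: "alg_closed_field TYPE('a)" and M: "subfield M" and dense: "alg_dense M"
    and x: "x \<notin> perfect_closure M"
  shows "\<exists>\<sigma> \<in> Aut M. \<sigma> x \<noteq> x"
proof -
  have "algebraic_over M x" using dense unfolding alg_dense_def by blast
  from minimal_polynomial_exists[OF M this] obtain p where p: "p \<in> poly_over M" "lead_coeff p = 1" "degree p > 0"
    "\<And>f. f \<in> poly_over M \<Longrightarrow> poly f x = 0 \<Longrightarrow> \<exists>q \<in> poly_over M. f = q * p" by metis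
  have "\<exists>x'. poly p x' = 0 \<and> x' \<noteq> x"
  proof (rule ccontr)
    assume "\<not> ?thesis"
    hence "p = [:- x, 1:] ^ degree p"
      using monic_single_root_eq_linear_power[OF closed p(2)] by blast
    hence "[:- x, 1:] ^ degree p \<in> poly_over M" using p by simp
    thus False using purely_inseparable_if_linear_power_over[OF M p(3)] x by blast
  qed
  thus ?thesis using Aut_maps_to_conjugate[OF closed M dense p(1) p(4)] by blast
qed

text \<open>Since \<open>x\<close> is transcendental, membership of \<open>x ^ q\<close> in
  \<open>M(x^2 + x)\<close> amounts to an identity of polynomials, which may be evaluated at
  \<open>- 1 - x\<close>. This yields \<open>(- 1 - x) ^ q = x ^ q\<close>, hence
  \<open>1 + 2 x = 0\<close>, contrary to transcendence.\<close>

lemma transcendental_not_in_perfect_closure_adjoin: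
  fixes M :: "'a::field set"
  assumes M: "subfield M" and x: "\<not> algebraic_over M x"
  shows "x \<notin> perfect_closure (adjoin M (x^2 + x))"
proof
  assume "x \<in> perfect_closure (adjoin M (x^2 + x))"
  then obtain n where "x ^ char_exp TYPE('a) n \<in> adjoin M (x^2 + x)" using perfect_closure_iff by blast
  moreover define q where "q = char_exp TYPE('a) n"
  ultimately obtain f g where fg: "f \<in> poly_over M" "g \<in> poly_over M" "poly g (x^2 + x) \<noteq> 0"
    "x ^ q = poly f (x^2 + x) / poly g (x^2 + x)"
    unfolding adjoin_def by auto
  define u :: "'a poly" where "u = [:0, 1, 1:]"
  have u: "u \<in> poly_over M" "poly u z = z^2 + z" for z
    by (auto simp: u_def poly_over_pCons_iff[OF M] poly_over_0[OF M] subfield_closed[OF M] power2_eq_square algebra_simps)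
  define h where "h = monom 1 q * pcompose g u - pcompose f u"
  have h: "h \<in> poly_over M"
    unfolding h_def using fg u
    by (intro poly_over_diff poly_over_mult poly_over_monom poly_over_pcompose M subfield_1)
  have ph: "poly h z = z ^ q * poly g (z^2 + z) - poly f (z^2 + z)" for z
    by (simp add: h_def poly_monom poly_pcompose u)
  have "poly h x = 0" using fg by (simp add: ph)
  hence "h = 0" using h x unfolding algebraic_over_iff by blast
  define y where "y = - 1 - x"
  have y: "y^2 + y = x^2 + x" by (simp add: y_def power2_eq_square algebra_simps)
  have "poly h y = 0" using \<open>h = 0\<close> by simp
  hence "y ^ q * poly g (x^2 + x) = x ^ q * poly g (x^2 + x)" using fg(3,4) unfolding ph y by simp
  hence "y ^ q = x ^ q" using fg(3) by simp
  hence "y = x" unfolding q_def by (rule power_char_exp_inj)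
  hence "- 1 = x + x" unfolding y_def by (simp add: diff_eq_eq)
  hence eq: "1 + 2 * x = 0" by (metis add.right_inverse mult_2)
  \<comment> \<open>The constant term \<open>1\<close> keeps this polynomial nonzero even in
    characteristic two.\<close>
  have "[:1, 2:] \<in> poly_over M"
    using subfield_of_nat[OF M, of 2] by (simp add: poly_over_pCons_iff[OF M] poly_over_0[OF M] subfield_1[OF M])
  moreover have "poly [:1, 2:] x = 0" using eq by (simp add: mult.commute)
  moreover have "[:1, 2:] \<noteq> (0 :: 'a poly)" by simp
  ultimately show False using x unfolding algebraic_over_iff by blast
qed

text \<open>Some power \<open>r\<close> of \<open>x\<close> equals
  \<open>poly f y / poly g y\<close>. As \<open>y\<close> is transcendental also over
  \<open>M(x)\<close>, the polynomial \<open>f - r g\<close> is zero, and comparing coefficients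
  writes \<open>r\<close> as a quotient of elements of \<open>M\<close>.\<close>

lemma algebraic_in_perfect_closure_adjoin_transcendental:
  fixes M :: "'a::field set"
  assumes M: "subfield M" and x: "algebraic_over M x" and y: "\<not> algebraic_over M y"
    and mem: "x \<in> perfect_closure (adjoin M y)"
  shows "x \<in> perfect_closure M"
proof -
  obtain n where n: "x ^ char_exp TYPE('a) n \<in> adjoin M y" using mem perfect_closure_iff by blast
  define r where "r = x ^ char_exp TYPE('a) n"
  obtain f g where fg: "f \<in> poly_over M" "g \<in> poly_over M" "poly g y \<noteq> 0" "r = poly f y / poly g y"
    using n unfolding adjoin_def r_def by auto
  note E = subfield_adjoin[OF M, of x]
  have "r \<in> adjoin M x" unfolding r_def by (intro subfield_power E adjoin_self[OF M])
  hence "f - smult r g \<in> poly_over (adjoin M x)"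
    using fg poly_over_mono[OF adjoin_superset[OF M]]
    by (intro poly_over_diff[OF E] poly_over_smult[OF E]) blast+
  moreover have "poly (f - smult r g) y = 0" using fg by simp
  ultimately have "f - smult r g = 0"
    using algebraic_over_adjoin_trans[OF M x] y algebraic_over_iff by blast
  hence "f = smult r g" by simp
  moreover obtain i where i: "coeff g i \<noteq> 0" using fg(3) by (metis coeff_0 poly_0 poly_eqI)
  ultimately have "r = coeff f i / coeff g i" by simp
  also have "\<dots> \<in> M" using fg by (intro subfield_divide[OF M]) (auto intro: poly_over_coeff)
  finally show ?thesis using perfect_closure_iff r_def by blast
qed

text \<open>Enlarging \<open>L\<close> shrinks \<open>Aut L\<close>, so it is enough to find the
  automorphism over a maximal extension of \<open>L\<close> whose perfect closure omits
  \<open>x\<close>.\<close>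

lemma moving_automorphism:
  fixes L :: "'a::field set"
  assumes closed: "alg_closed_field TYPE('a)" and L: "subfield L" and x: "x \<notin> perfect_closure L"
  shows "\<exists>\<sigma> \<in> Aut L. \<sigma> x \<noteq> x"
proof -
  define \<A> where "\<A> = {M. subfield M \<and> L \<subseteq> M \<and> x \<notin> perfect_closure M}"
  have "L \<in> \<A>" using L x by (auto simp: \<A>_def)
  moreover have "\<Union>C \<in> \<A>" if C: "C \<noteq> {}" "subset.chain \<A> C" for C
  proof -
    have CA: "subfield M" "L \<subseteq> M" "x \<notin> perfect_closure M" if "M \<in> C" for M
      using C that unfolding subset.chain_def \<A>_def by auto
    have pair: "\<exists>M\<in>C. u \<in> M \<and> v \<in> M" if "u \<in> \<Union>C" "v \<in> \<Union>C" for u v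
      using that C(2) unfolding subset_chain_def by blast
    have "u + v \<in> \<Union>C \<and> u - v \<in> \<Union>C \<and> u * v \<in> \<Union>C" if "u \<in> \<Union>C" "v \<in> \<Union>C" for u v
      using pair[OF that] CA(1) unfolding subfield_def by (meson UnionI)
    moreover have "inverse u \<in> \<Union>C" if "u \<in> \<Union>C" for u
      using that CA(1) subfield_inverse by blast
    moreover have "0 \<in> \<Union>C" "1 \<in> \<Union>C" "L \<subseteq> \<Union>C"
      using C(1) CA subfield_0 subfield_1 by blast+
    \<comment> \<open>Membership in a perfect closure is witnessed by a single power, which lies in
      one member of the chain.\<close>
    moreover have "x \<notin> perfect_closure (\<Union>C)"
      using CA(3) unfolding perfect_closure_iff by blast
    ultimately show ?thesis unfolding \<A>_def subfield_def by blast
  qed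
  ultimately obtain M where "M \<in> \<A>" and max: "\<And>T. T \<in> \<A> \<Longrightarrow> M \<subseteq> T \<Longrightarrow> T = M"
    using subset_Zorn_nonempty[of \<A>] by blast
  hence M: "subfield M" "L \<subseteq> M" "x \<notin> perfect_closure M" by (auto simp: \<A>_def)
  have adj: "y \<in> M" if "x \<notin> perfect_closure (adjoin M y)" for y
  proof -
    have "adjoin M y \<in> \<A>"
      using that M subfield_adjoin[OF M(1)] adjoin_superset[OF M(1)] by (auto simp: \<A>_def)
    hence "adjoin M y = M" using max adjoin_superset[OF M(1)] by blast
    thus ?thesis using adjoin_self[OF M(1)] by blast
  qed
  have x_alg: "algebraic_over M x"
  proof (rule ccontr)
    assume "\<not> algebraic_over M x"
    hence mem: "x^2 + x \<in> M" using adj transcendental_not_in_perfect_closure_adjoin[OF M(1)] by blast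
    have "[:- (x^2 + x), 1, 1:] \<in> poly_over M"
      using mem by (auto simp: poly_over_pCons_iff[OF M(1)] poly_over_0[OF M(1)] subfield_1[OF M(1)] intro!: subfield_uminus[OF M(1)] simp del: minus_add_distrib)
    moreover have "poly [:- (x^2 + x), 1, 1:] x = 0" by (simp add: power2_eq_square algebra_simps)
    moreover have "[:- (x^2 + x), 1, 1:] \<noteq> 0" by simp
    ultimately show False using \<open>\<not> algebraic_over M x\<close> unfolding algebraic_over_iff by blast
  qed
  have "algebraic_over M y" for y
  proof (rule ccontr)
    assume y: "\<not> algebraic_over M y"
    have "x \<in> perfect_closure (adjoin M y)"
    proof (rule ccontr)
      assume "\<not> ?thesis"
      hence "y \<in> M" using adj by blast
      hence "[:- y, 1:] \<in> poly_over M"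
        by (simp add: poly_over_pCons_iff[OF M(1)] poly_over_0[OF M(1)] subfield_closed[OF M(1)])
      moreover have "poly [:- y, 1:] y = 0" "[:- y, 1:] \<noteq> 0" by simp_all
      ultimately show False using y unfolding algebraic_over_iff by blast
    qed
    thus False using algebraic_in_perfect_closure_adjoin_transcendental[OF M(1) x_alg y] M(3) by blast
  qed
  hence "alg_dense M" unfolding alg_dense_def by blast
  then obtain \<sigma> where "\<sigma> \<in> Aut M" "\<sigma> x \<noteq> x" using alg_dense_moving_automorphism[OF closed M(1)] M(3) by blast
  moreover have "Aut M \<subseteq> Aut L" using M(2) unfolding Aut_iff subset_iff by blast
  ultimately show ?thesis by blast
qed

section \<open>Fixed fields and the correspondence up to perfect equivalence\<close>

definition fixed_field :: "('a \<Rightarrow> 'a) set \<Rightarrow> 'a set" where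
  "fixed_field H = {x. \<forall>\<sigma>\<in>H. \<sigma> x = x}"

lemma fixed_field_Aut:
  fixes L :: "'a::field set"
  assumes "alg_closed_field TYPE('a)" "subfield L"
  shows "fixed_field (Aut L) = perfect_closure L"
  using moving_automorphism[OF assms] Aut_fixes_perfect_closure unfolding fixed_field_def by blast

lemma Aut_perfect_closure: "Aut (perfect_closure L) = Aut L"
proof -
  have "Aut (perfect_closure L) \<subseteq> Aut L"
    using perfect_closure_superset[of L] unfolding Aut_iff subset_iff by blast
  moreover have "\<sigma> \<in> Aut (perfect_closure L)" if "\<sigma> \<in> Aut L" for \<sigma>
    using Aut_fixes_perfect_closure[OF that] that unfolding Aut_iff by blast
  ultimately show ?thesis by blast
qed

text \<open>The perfect closure is recovered from the group as its fixed field; conversely the group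
  depends on the perfect closure alone.\<close>

lemma Aut_eq_iff_perfect_closure_eq:
  fixes L1 L2 :: "'a::field set"
  assumes "alg_closed_field TYPE('a)" "subfield L1" "subfield L2"
  shows "Aut L1 = Aut L2 \<longleftrightarrow> perfect_closure L1 = perfect_closure L2"
proof
  assume "Aut L1 = Aut L2"
  thus "perfect_closure L1 = perfect_closure L2"
    using fixed_field_Aut[OF assms(1,2)] fixed_field_Aut[OF assms(1,3)] by simp
next
  assume "perfect_closure L1 = perfect_closure L2"
  thus "Aut L1 = Aut L2" using Aut_perfect_closure[of L1] Aut_perfect_closure[of L2] by simp
qed

section \<open>The topology of pointwise convergence\<close>

abbreviation pointwise_topology :: "('a \<Rightarrow> 'b) topology" where
  "pointwise_topology \<equiv> product_topology (\<lambda>_. discrete_topology UNIV) UNIV"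

text \<open>Open boxes in a product of discrete spaces restrict finitely many values and may be
  shrunk to singletons there, so openness becomes a matter of finite agreement.\<close>

lemma openin_pointwise_topology:
  "openin pointwise_topology A \<longleftrightarrow> (\<forall>\<sigma>\<in>A. \<exists>S. finite S \<and> (\<forall>\<tau>. (\<forall>s\<in>S. \<tau> s = \<sigma> s) \<longrightarrow> \<tau> \<in> A))"
proof
  assume A: "openin pointwise_topology A"
  show "\<forall>\<sigma>\<in>A. \<exists>S. finite S \<and> (\<forall>\<tau>. (\<forall>s\<in>S. \<tau> s = \<sigma> s) \<longrightarrow> \<tau> \<in> A)"
  proof
    fix \<sigma> assume "\<sigma> \<in> A"
    then obtain U where U: "finite {i. U i \<noteq> UNIV}" "\<sigma> \<in> Pi\<^sub>E UNIV U" "Pi\<^sub>E UNIV U \<subseteq> A"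
      using A unfolding openin_product_topology_alt by auto
    have "\<tau> \<in> A" if "\<forall>s\<in>{i. U i \<noteq> UNIV}. \<tau> s = \<sigma> s" for \<tau>
    proof -
      have "\<tau> i \<in> U i" for i
        using that U(2) by (cases "U i = UNIV") (auto simp: PiE_iff)
      hence "\<tau> \<in> Pi\<^sub>E UNIV U" by (auto simp: PiE_iff)
      thus ?thesis using U(3) by blast
    qed
    thus "\<exists>S. finite S \<and> (\<forall>\<tau>. (\<forall>s\<in>S. \<tau> s = \<sigma> s) \<longrightarrow> \<tau> \<in> A)" using U(1) by blast
  qed
next
  assume A: "\<forall>\<sigma>\<in>A. \<exists>S. finite S \<and> (\<forall>\<tau>. (\<forall>s\<in>S. \<tau> s = \<sigma> s) \<longrightarrow> \<tau> \<in> A)"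
  show "openin pointwise_topology A"
    unfolding openin_product_topology_alt
  proof (intro ballI)
    fix \<sigma> assume "\<sigma> \<in> A"
    then obtain S where S: "finite S" "\<And>\<tau>. (\<forall>s\<in>S. \<tau> s = \<sigma> s) \<Longrightarrow> \<tau> \<in> A" using A by blast
    define U where "U = (\<lambda>i. if i \<in> S then {\<sigma> i} else UNIV)"
    have "finite {i \<in> UNIV. U i \<noteq> topspace (discrete_topology UNIV)}"
      using S(1) by (rule rev_finite_subset) (auto simp: U_def)
    moreover have "\<sigma> \<in> Pi\<^sub>E UNIV U" by (auto simp: U_def PiE_iff)
    moreover have "Pi\<^sub>E UNIV U \<subseteq> A"
    proof
      fix \<tau> assume "\<tau> \<in> Pi\<^sub>E UNIV U"
      hence "\<tau> s \<in> U s" for s by (auto simp: PiE_iff)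
      hence "\<tau> s = \<sigma> s" if "s \<in> S" for s using that unfolding U_def by (metis singletonD)
      thus "\<tau> \<in> A" using S(2) by blast
    qed
    ultimately show "\<exists>U. finite {i \<in> UNIV. U i \<noteq> topspace (discrete_topology UNIV)} \<and>
        (\<forall>i\<in>UNIV. openin (discrete_topology UNIV) (U i)) \<and> \<sigma> \<in> Pi\<^sub>E UNIV U \<and> Pi\<^sub>E UNIV U \<subseteq> A"
      by (intro exI[of _ U]) auto
  qed
qed

lemma closedin_pointwise_topology:
  "closedin pointwise_topology A \<longleftrightarrow> (\<forall>\<sigma>. \<sigma> \<notin> A \<longrightarrow> (\<exists>S. finite S \<and> (\<forall>\<tau>. (\<forall>s\<in>S. \<tau> s = \<sigma> s) \<longrightarrow> \<tau> \<notin> A)))"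
  unfolding closedin_def openin_pointwise_topology by (auto simp: PiE_UNIV_domain)

lemma Hausdorff_pointwise_topology: "Hausdorff_space pointwise_topology"
  by (simp add: Hausdorff_space_product_topology Hausdorff_space_discrete_topology)

lemma compactin_Gal_top: "compactin (Gal_top k) H \<longleftrightarrow> compactin pointwise_topology H \<and> H \<subseteq> Aut k"
  unfolding Gal_top_def by (rule compactin_subtopology)

text \<open>Evaluation at \<open>x\<close> is continuous, and compact subsets of a discrete space
  are finite.\<close>

lemma finite_orbit_if_compact:
  assumes "compactin pointwise_topology H"
  shows "finite ((\<lambda>\<sigma>. \<sigma> x) ` H)"
  using image_compactin[OF assms continuous_map_product_projection[of x UNIV]]
  by (simp add: compactin_discrete_topology)

text \<open>By Tychonoff's theorem the product of the finite sets \<open>Z x\<close> is compact, and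
  \<open>A\<close> is a closed part of it.\<close>

lemma compactin_pointwise_if_in_finite_sets:
  assumes "closedin pointwise_topology A" "\<And>x. finite (Z x)" "\<And>\<sigma> x. \<sigma> \<in> A \<Longrightarrow> \<sigma> x \<in> Z x"
  shows "compactin pointwise_topology A"
proof (rule closed_compactin[OF _ _ assms(1)])
  show "compactin pointwise_topology (Pi\<^sub>E UNIV Z)"
    by (simp add: compactin_PiE compactin_discrete_topology assms(2))
  show "A \<subseteq> Pi\<^sub>E UNIV Z" using assms(3) by (auto simp: PiE_iff)
qed

text \<open>A violated homomorphism law or a moved element of \<open>L\<close> shows on at most
  three arguments. A failure of surjectivity does not show on finitely many, so the set consists of
  endomorphisms.\<close>

lemma closedin_ring_homs_fixing:
  "closedin pointwise_topology {\<sigma> :: 'a::field \<Rightarrow> 'a. ring_hom_on UNIV \<sigma> \<and> (\<forall>x\<in>L. \<sigma> x = x)}"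
  unfolding closedin_pointwise_topology
proof (intro allI impI)
  fix \<sigma> :: "'a \<Rightarrow> 'a"
  assume "\<sigma> \<notin> {\<sigma>. ring_hom_on UNIV \<sigma> \<and> (\<forall>x\<in>L. \<sigma> x = x)}"
  then consider "\<sigma> 1 \<noteq> 1" | x y where "\<sigma> (x + y) \<noteq> \<sigma> x + \<sigma> y" | x y where "\<sigma> (x * y) \<noteq> \<sigma> x * \<sigma> y"
    | x where "x \<in> L" "\<sigma> x \<noteq> x"
    unfolding ring_hom_on_UNIV_iff by auto
  thus "\<exists>S. finite S \<and> (\<forall>\<tau>. (\<forall>s\<in>S. \<tau> s = \<sigma> s) \<longrightarrow> \<tau> \<notin> {\<sigma>. ring_hom_on UNIV \<sigma> \<and> (\<forall>x\<in>L. \<sigma> x = x)})"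
  proof cases
    case 1
    thus ?thesis by (intro exI[of _ "{1}"]) (auto simp: ring_hom_on_UNIV_iff)
  next
    case (2 x y)
    thus ?thesis by (intro exI[of _ "{x, y, x + y}"]) (auto simp: ring_hom_on_UNIV_iff)
  next
    case (3 x y)
    thus ?thesis by (intro exI[of _ "{x, y, x * y}"]) (auto simp: ring_hom_on_UNIV_iff)
  next
    case (4 x)
    thus ?thesis by (intro exI[of _ "{x}"]) (metis (mono_tags, lifting) finite.intros insertI1 mem_Collect_eq)
  qed
qed

lemma Aut_antimono: "K \<subseteq> L \<Longrightarrow> Aut L \<subseteq> Aut K"
  unfolding Aut_iff subset_iff by blast

text \<open>As \<open>F|L\<close> is algebraic, \<open>Aut L\<close> consists of all endomorphisms
  over \<open>L\<close> and is closed in the full product. Each \<open>x\<close> can only go to a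
  root of a fixed polynomial over \<open>L\<close> that annihilates it, so the values lie in finite
  sets.\<close>

lemma compactin_Aut_if_alg_dense:
  fixes L :: "'a::field set"
  assumes "alg_dense L" "k \<subseteq> L"
  shows "compactin (Gal_top k) (Aut L)"
proof -
  have eq: "Aut L = {\<sigma>. ring_hom_on UNIV \<sigma> \<and> (\<forall>x\<in>L. \<sigma> x = x)}"
    using hom_fixing_alg_dense_in_Aut[OF assms(1)] by (auto simp: Aut_iff)
  have "\<exists>p. p \<noteq> 0 \<and> p \<in> poly_over L \<and> poly p x = 0" for x
    using assms unfolding alg_dense_def algebraic_over_iff by blast
  then obtain p where p: "\<And>x. p x \<noteq> 0" "\<And>x. p x \<in> poly_over L" "\<And>x. poly (p x) x = 0" by metis
  have "poly (p x) (\<sigma> x) = 0" if "\<sigma> \<in> Aut L" for \<sigma> x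
  proof -
    have hom: "ring_hom_on UNIV \<sigma>" and fixed: "\<And>z. z \<in> L \<Longrightarrow> \<sigma> z = z" using that by (auto simp: Aut_iff)
    have "map_poly \<sigma> (p x) = p x"
      using p(2)[of x] fixed ring_hom_on_zero[OF hom] by (intro poly_eqI) (auto simp: coeff_map_poly poly_over_def)
    thus ?thesis using poly_map_poly_hom[OF hom, of "p x" x] p(3) ring_hom_on_zero[OF hom] by simp
  qed
  moreover have "finite {z. poly (p x) z = 0}" for x using p(1) by (rule poly_roots_finite)
  ultimately have "compactin pointwise_topology (Aut L)"
    by (intro compactin_pointwise_if_in_finite_sets[where Z = "\<lambda>x. {z. poly (p x) z = 0}"])
       (simp_all add: eq closedin_ring_homs_fixing)
  thus ?thesis using Aut_antimono[OF assms(2)] by (simp add: compactin_Gal_top)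
qed

lemma closedin_Aut:
  assumes "k \<subseteq> L"
  shows "closedin (Gal_top k) (Aut L)"
proof -
  have "Aut L = {\<sigma>. ring_hom_on UNIV \<sigma> \<and> (\<forall>x\<in>L. \<sigma> x = x)} \<inter> Aut k"
    using assms unfolding Aut_iff set_eq_iff Int_iff mem_Collect_eq Aut_iff subset_iff by blast
  thus ?thesis unfolding Gal_top_def closedin_subtopology using closedin_ring_homs_fixing by blast
qed

lemma is_subgroup_Aut:
  assumes "k \<subseteq> L"
  shows "is_subgroup (Aut L) (Aut k)"
  unfolding is_subgroup_def
proof (intro conjI ballI)
  show "Aut L \<subseteq> Aut k" using Aut_antimono[OF assms] .
  show "id \<in> Aut L" by (auto simp: Aut_iff ring_hom_on_UNIV_iff)
  show "\<sigma> \<circ> \<tau> \<in> Aut L" if "\<sigma> \<in> Aut L" "\<tau> \<in> Aut L" for \<sigma> \<tau>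
    using that by (auto simp: Aut_iff ring_hom_on_UNIV_iff bij_comp)
  show "inv \<sigma> \<in> Aut L" if "\<sigma> \<in> Aut L" for \<sigma>
  proof -
    have bij: "bij \<sigma>" and hom: "\<sigma> 1 = 1" "\<And>x y. \<sigma> (x + y) = \<sigma> x + \<sigma> y" "\<And>x y. \<sigma> (x * y) = \<sigma> x * \<sigma> y"
      and fixed: "\<And>x. x \<in> L \<Longrightarrow> \<sigma> x = x"
      using that by (auto simp: Aut_iff ring_hom_on_UNIV_iff)
    have inv: "inv \<sigma> z = w \<longleftrightarrow> z = \<sigma> w" for z w
      using bij by (metis bij_inv_eq_iff)
    have "\<sigma> (inv \<sigma> z) = z" for z using inv by metis
    hence "ring_hom_on UNIV (inv \<sigma>)" by (simp add: ring_hom_on_UNIV_iff inv hom)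
    thus ?thesis using bij fixed by (auto simp: Aut_iff inv bij_imp_bij_inv)
  qed
qed

lemma subfield_fixed_field:
  assumes "H \<subseteq> Aut k"
  shows "subfield (fixed_field H)"
  unfolding subfield_def fixed_field_def mem_Collect_eq
proof (intro conjI ballI)
  fix \<sigma> assume "\<sigma> \<in> H"
  hence hom: "ring_hom_on UNIV \<sigma>" using assms by (auto simp: Aut_iff)
  show "\<sigma> 0 = 0" "\<sigma> 1 = 1" using ring_hom_on_zero[OF hom] ring_hom_on_one[OF hom] by auto
  fix x y assume "x \<in> {x. \<forall>\<sigma>\<in>H. \<sigma> x = x}"
  hence x: "\<sigma> x = x" using \<open>\<sigma> \<in> H\<close> by blast
  show "\<sigma> (inverse x) = inverse x" using ring_hom_on_inverse[OF hom] x by simp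
  assume "y \<in> {x. \<forall>\<sigma>\<in>H. \<sigma> x = x}"
  hence y: "\<sigma> y = y" using \<open>\<sigma> \<in> H\<close> by blast
  show "\<sigma> (x + y) = x + y" "\<sigma> (x - y) = x - y" "\<sigma> (x * y) = x * y"
    using x y by (simp_all add: ring_hom_on_add[OF hom] ring_hom_on_diff[OF hom] ring_hom_on_mult[OF hom])
qed

text \<open>The fixed field of a single automorphism is a subfield, so fixing the generators means
  fixing everything they generate. For finite \<open>S\<close> these are the basic open
  subgroups.\<close>

lemma Aut_field_generated: "Aut (field_generated (k \<union> S)) = {\<sigma> \<in> Aut k. \<forall>s\<in>S. \<sigma> s = s}"
proof (intro equalityI subsetI)
  fix \<sigma> assume "\<sigma> \<in> Aut (field_generated (k \<union> S))"
  thus "\<sigma> \<in> {\<sigma> \<in> Aut k. \<forall>s\<in>S. \<sigma> s = s}"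
    using field_generated_superset[of "k \<union> S"] by (auto simp: Aut_iff)
next
  fix \<sigma> assume \<sigma>: "\<sigma> \<in> {\<sigma> \<in> Aut k. \<forall>s\<in>S. \<sigma> s = s}"
  have "subfield (fixed_field {\<sigma>})" using \<sigma> by (intro subfield_fixed_field[of _ k]) auto
  moreover have "k \<union> S \<subseteq> fixed_field {\<sigma>}" using \<sigma> by (auto simp: fixed_field_def Aut_iff)
  ultimately have "field_generated (k \<union> S) \<subseteq> fixed_field {\<sigma>}" by (rule field_generated_least)
  thus "\<sigma> \<in> Aut (field_generated (k \<union> S))" using \<sigma> by (auto simp: fixed_field_def Aut_iff)
qed

lemma openin_Aut_if_fin_gen:
  assumes "fin_gen_over k L"
  shows "openin (Gal_top k) (Aut L)"
proof -
  obtain S where S: "finite S" "L = field_generated (k \<union> S)" using assms unfolding fin_gen_over_def by blast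
  have "openin pointwise_topology {\<sigma>. \<forall>s\<in>S. \<sigma> s = s}"
    unfolding openin_pointwise_topology using S(1) by force
  moreover have "Aut L = {\<sigma>. \<forall>s\<in>S. \<sigma> s = s} \<inter> Aut k" unfolding S(2) Aut_field_generated by blast
  ultimately show ?thesis unfolding Gal_top_def openin_subtopology by blast
qed

section \<open>Compact subgroups\<close>

text \<open>Two coefficient rings occur: the field itself for orbits of elements, and the polynomial
  ring over it for orbits of polynomials.\<close>

lemma map_poly_prod_linear:
  fixes f :: "'b::comm_ring_1 \<Rightarrow> 'b"
  assumes hom: "ring_hom_on UNIV f"
  shows "map_poly f (\<Prod>\<eta>\<in>Orb. [:- \<eta>, 1:]) = (\<Prod>\<eta>\<in>Orb. [:- f \<eta>, 1:])"
proof (induction Orb rule: infinite_finite_induct)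
  case (insert \<eta> Orb)
  have "map_poly f [:- \<eta>, 1:] = [:- f \<eta>, 1:]"
    by (simp add: map_poly_pCons ring_hom_on_zero[OF hom] ring_hom_on_one[OF hom] ring_hom_on_uminus[OF hom])
  thus ?case using insert map_poly_hom_mult[OF hom]
    by (simp add: poly_over_def del: mult_pCons_left)
qed (simp_all add: ring_hom_on_one[OF hom])

lemma map_poly_prod_linear_invariant:
  fixes f :: "'b::comm_ring_1 \<Rightarrow> 'b"
  assumes hom: "ring_hom_on UNIV f" and "inj_on f Orb" "f ` Orb = Orb"
  shows "map_poly f (\<Prod>\<eta>\<in>Orb. [:- \<eta>, 1:]) = (\<Prod>\<eta>\<in>Orb. [:- \<eta>, 1:])"
  unfolding map_poly_prod_linear[OF hom]
  using prod.reindex[OF assms(2), of "\<lambda>\<eta>. [:- \<eta>, 1:]"] assms(3) by simp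

text \<open>The action \<open>A\<close> is abstract because it stands both for applying
  \<open>\<sigma>\<close> to an element and for \<open>map_poly\<close>.\<close>

lemma orbit_invariant:
  assumes H: "is_subgroup H (Aut k)" and act: "\<And>\<sigma> \<tau>. \<sigma> \<in> H \<Longrightarrow> \<tau> \<in> H \<Longrightarrow> A \<sigma> (A \<tau> \<theta>) = A (\<sigma> \<circ> \<tau>) \<theta>"
    and "\<tau> \<in> H"
  shows "A \<tau> ` (\<lambda>\<sigma>. A \<sigma> \<theta>) ` H = (\<lambda>\<sigma>. A \<sigma> \<theta>) ` H"
proof (intro equalityI subsetI)
  fix z assume "z \<in> A \<tau> ` (\<lambda>\<sigma>. A \<sigma> \<theta>) ` H"
  then obtain \<sigma> where "\<sigma> \<in> H" "z = A \<tau> (A \<sigma> \<theta>)" by blast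
  thus "z \<in> (\<lambda>\<sigma>. A \<sigma> \<theta>) ` H" using act H \<open>\<tau> \<in> H\<close> unfolding is_subgroup_def by blast
next
  fix z assume "z \<in> (\<lambda>\<sigma>. A \<sigma> \<theta>) ` H"
  then obtain \<sigma> where \<sigma>: "\<sigma> \<in> H" "z = A \<sigma> \<theta>" by blast
  have "inv \<tau> \<circ> \<sigma> \<in> H" using \<sigma> H \<open>\<tau> \<in> H\<close> unfolding is_subgroup_def by blast
  moreover have "bij \<tau>" using H \<open>\<tau> \<in> H\<close> by (auto simp: is_subgroup_def Aut_iff)
  hence "\<tau> \<circ> (inv \<tau> \<circ> \<sigma>) = \<sigma>" by (auto simp: fun_eq_iff bij_is_surj surj_f_inv_f)
  ultimately have "z = A \<tau> (A (inv \<tau> \<circ> \<sigma>) \<theta>)" using act \<sigma> \<open>\<tau> \<in> H\<close> by simp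
  thus "z \<in> A \<tau> ` (\<lambda>\<sigma>. A \<sigma> \<theta>) ` H" using \<open>inv \<tau> \<circ> \<sigma> \<in> H\<close> by blast
qed

text \<open>\<open>H\<close> permutes the orbit of \<open>x\<close> and so fixes the coefficients;
  \<open>x\<close> is a root because \<open>id\<close> lies in \<open>H\<close>.\<close>

lemma orbit_polynomial_over_fixed_field:
  fixes k :: "'a::field set"
  assumes H: "is_subgroup H (Aut k)" and fin: "finite ((\<lambda>\<sigma>. \<sigma> x) ` H)"
  shows "(\<Prod>\<eta>\<in>(\<lambda>\<sigma>. \<sigma> x) ` H. [:- \<eta>, 1:]) \<in> poly_over (fixed_field H)"
    and "poly (\<Prod>\<eta>\<in>(\<lambda>\<sigma>. \<sigma> x) ` H. [:- \<eta>, 1:]) x = 0"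
    and "(\<Prod>\<eta>\<in>(\<lambda>\<sigma>. \<sigma> x) ` H. [:- \<eta>, 1:]) \<noteq> 0"
proof -
  let ?O = "(\<lambda>\<sigma>. \<sigma> x) ` H"
  let ?P = "\<Prod>\<eta>\<in>?O. [:- \<eta>, 1:]"
  have "\<tau> (coeff ?P i) = coeff ?P i" if "\<tau> \<in> H" for \<tau> i
  proof -
    have \<tau>: "bij \<tau>" "ring_hom_on UNIV \<tau>" using that H by (auto simp: is_subgroup_def Aut_iff)
    have "map_poly \<tau> ?P = ?P"
      using \<tau> orbit_invariant[OF H, of "\<lambda>\<sigma>. \<sigma>" x \<tau>] that
      by (intro map_poly_prod_linear_invariant) (auto simp: bij_def intro: inj_on_subset)
    thus ?thesis using coeff_map_poly[of \<tau> ?P i] ring_hom_on_zero[OF \<tau>(2)] by simp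
  qed
  thus "?P \<in> poly_over (fixed_field H)" by (auto simp: poly_over_def fixed_field_def)
  have "id \<in> H" using H by (auto simp: is_subgroup_def)
  hence "x \<in> ?O" using image_eqI[of x "\<lambda>\<sigma>. \<sigma> x" id H] by simp
  thus "poly ?P x = 0" using fin by (auto simp: poly_prod prod_zero_iff)
  show "?P \<noteq> 0" using fin by (simp add: prod_zero_iff)
qed

lemma alg_dense_fixed_field_compact:
  fixes k :: "'a::field set"
  assumes "is_subgroup H (Aut k)" "compactin (Gal_top k) H"
  shows "alg_dense (fixed_field H)"
  using orbit_polynomial_over_fixed_field[OF assms(1)] finite_orbit_if_compact[of H] assms(2)
  unfolding alg_dense_def algebraic_over_iff compactin_Gal_top by blast

text \<open>Encoding the finite set as the coefficients of one polynomial \<open>\<theta>\<close> over \<open>F\<close> replaces the primitive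
  element theorem: the orbit polynomial of \<open>\<theta>\<close> has its coefficients in \<open>L[T]\<close>, where \<open>L\<close> is the fixed
  field of \<open>H\<close>, so \<open>\<sigma>\<close> permutes its roots.\<close>

lemma Aut_fixed_field_approx:
  fixes k :: "'a::field set"
  assumes H: "is_subgroup H (Aut k)" and fin: "\<And>x. finite ((\<lambda>\<sigma>. \<sigma> x) ` H)"
    and \<sigma>: "\<sigma> \<in> Aut (fixed_field H)" and S: "finite S"
  shows "\<exists>\<tau>\<in>H. \<forall>s\<in>S. \<tau> s = \<sigma> s"
proof -
  obtain xs where xs: "set xs = S" using S finite_list by blast
  define \<theta> where "\<theta> = Poly xs"
  define Orb where "Orb = (\<lambda>\<tau>. map_poly \<tau> \<theta>) ` H"
  define Q where "Q = (\<Prod>\<eta>\<in>Orb. [:- \<eta>, 1:])"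
  have homH: "ring_hom_on UNIV \<tau>" "bij \<tau>" if "\<tau> \<in> H" for \<tau>
    using that H by (auto simp: is_subgroup_def Aut_iff)
  have hom\<sigma>: "ring_hom_on UNIV \<sigma>" using \<sigma> by (simp add: Aut_iff)
  have mpP: "map_poly \<tau> (Poly ys) = Poly (map \<tau> ys)" if "ring_hom_on UNIV \<tau>" for \<tau> :: "'a \<Rightarrow> 'a" and ys
    by (induction ys) (simp_all add: map_poly_pCons ring_hom_on_zero[OF that])
  \<comment> \<open>\<open>U\<close> contains all coefficients of conjugates of
    \<open>\<theta>\<close>. It is finite because orbits are, so \<open>\<theta>\<close> has
    finitely many conjugates even when \<open>H\<close> is infinite.\<close>
  define U where "U = (\<Union>s\<in>S. (\<lambda>\<tau>. \<tau> s) ` H)"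
  have "finite {ys. set ys \<subseteq> U \<and> length ys = length xs}"
    using S fin by (intro finite_lists_length_eq) (auto simp: U_def)
  moreover have "Orb \<subseteq> Poly ` {ys. set ys \<subseteq> U \<and> length ys = length xs}"
    unfolding Orb_def \<theta>_def
  proof (intro image_subsetI)
    fix \<tau> assume "\<tau> \<in> H"
    thus "map_poly \<tau> (Poly xs) \<in> Poly ` {ys. set ys \<subseteq> U \<and> length ys = length xs}"
      unfolding mpP[OF homH(1)[OF \<open>\<tau> \<in> H\<close>]] by (intro imageI) (auto simp: U_def xs[symmetric])
  qed
  ultimately have finO: "finite Orb" by (meson finite_imageI finite_subset)
  have QH: "map_poly (map_poly \<tau>) Q = Q" if "\<tau> \<in> H" for \<tau>
    unfolding Q_def
  proof (rule map_poly_prod_linear_invariant)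
    show "ring_hom_on UNIV (map_poly \<tau>)" using ring_hom_on_map_poly homH(1)[OF that] by blast
    have "inj (map_poly \<tau>)"
    proof (rule injI)
      fix p q assume "map_poly \<tau> p = map_poly \<tau> q"
      hence "\<tau> (coeff p i) = \<tau> (coeff q i)" for i
        using coeff_map_poly ring_hom_on_zero[OF homH(1)[OF that]] by metis
      thus "p = q" using bij_is_inj[OF homH(2)[OF that]] by (intro poly_eqI) (auto dest: injD)
    qed
    thus "inj_on (map_poly \<tau>) Orb" by (rule inj_on_subset) simp
    show "map_poly \<tau> ` Orb = Orb"
      unfolding Orb_def using ring_hom_on_zero[OF homH(1)] that
      by (intro orbit_invariant[OF H, where A = map_poly]) (simp_all add: map_poly_map_poly)
  qed
  have "\<sigma> (coeff (coeff Q i) j) = coeff (coeff Q i) j" for i j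
  proof -
    have "\<tau> (coeff (coeff Q i) j) = coeff (coeff Q i) j" if "\<tau> \<in> H" for \<tau>
      using arg_cong[OF QH[OF that], of "\<lambda>Q. coeff (coeff Q i) j"] ring_hom_on_zero[OF homH(1)[OF that]]
      by (simp add: coeff_map_poly)
    hence "coeff (coeff Q i) j \<in> fixed_field H" by (simp add: fixed_field_def)
    thus ?thesis using \<sigma> by (simp add: Aut_iff)
  qed
  hence Q\<sigma>: "map_poly (map_poly \<sigma>) Q = Q"
    by (intro poly_eqI) (simp add: coeff_map_poly ring_hom_on_zero[OF hom\<sigma>])
  have "id \<in> H" using H by (simp add: is_subgroup_def)
  hence "\<theta> \<in> Orb" unfolding Orb_def by force
  hence "poly Q \<theta> = 0" using finO by (auto simp: Q_def poly_prod prod_zero_iff)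
  hence "poly Q (map_poly \<sigma> \<theta>) = 0"
    using poly_map_poly_hom[OF ring_hom_on_map_poly[OF hom\<sigma>], of Q \<theta>] Q\<sigma> by simp
  hence "map_poly \<sigma> \<theta> \<in> Orb" using finO by (auto simp: Q_def poly_prod prod_zero_iff)
  then obtain \<tau> where \<tau>: "\<tau> \<in> H" "map_poly \<sigma> \<theta> = map_poly \<tau> \<theta>" unfolding Orb_def by blast
  have "\<tau> s = \<sigma> s" if "s \<in> S" for s
  proof -
    obtain i where i: "i < length xs" "xs ! i = s" using \<open>s \<in> S\<close> unfolding xs[symmetric] in_set_conv_nth by blast
    \<comment> \<open>\<open>Poly\<close> drops trailing zeros of \<open>xs\<close>, but
      \<open>coeff\<close> reads them as zero, so every entry is still recovered.\<close>
    hence "coeff \<theta> i = s" by (simp add: \<theta>_def nth_default_nth)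
    thus ?thesis using arg_cong[OF \<tau>(2), of "\<lambda>p. coeff p i"]
      by (simp add: coeff_map_poly ring_hom_on_zero[OF hom\<sigma>] ring_hom_on_zero[OF homH(1)[OF \<tau>(1)]])
  qed
  thus ?thesis using \<tau> by blast
qed

text \<open>A compact set is closed in a Hausdorff space, and by
  \<open>Aut_fixed_field_approx\<close> every element of \<open>Aut (fixed_field H)\<close> lies in
  the closure of \<open>H\<close>.\<close>

lemma Aut_fixed_field_compact:
  fixes k :: "'a::field set"
  assumes H: "is_subgroup H (Aut k)" and comp: "compactin (Gal_top k) H"
  shows "Aut (fixed_field H) = H"
proof
  show "H \<subseteq> Aut (fixed_field H)"
    using H by (auto simp: is_subgroup_def Aut_iff fixed_field_def)
  have fin: "finite ((\<lambda>\<sigma>. \<sigma> x) ` H)" for x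
    using comp finite_orbit_if_compact by (auto simp: compactin_Gal_top)
  have "closedin pointwise_topology H"
    using comp compactin_imp_closedin[OF Hausdorff_pointwise_topology] by (auto simp: compactin_Gal_top)
  thus "Aut (fixed_field H) \<subseteq> H"
    using Aut_fixed_field_approx[OF H fin] unfolding closedin_pointwise_topology by blast
qed

section \<open>Compact open subgroups and finitely generated fields\<close>

lemma fixed_field_superset: "H \<subseteq> Aut k \<Longrightarrow> k \<subseteq> fixed_field H"
  by (auto simp: Aut_iff fixed_field_def)

text \<open>The fixed field equals its own perfect closure and may fail to be finitely generated, so
  a finitely generated subfield with the same automorphism group is built inside it.\<close>

lemma compact_open_subgroup_fin_gen:
  fixes k :: "'a::field set"
  assumes closed: "alg_closed_field TYPE('a)" and H: "is_subgroup H (Aut k)"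
    and comp: "compactin (Gal_top k) H" and op: "openin (Gal_top k) H"
  shows "\<exists>S. finite S \<and> alg_dense (field_generated (k \<union> S)) \<and> H = Aut (field_generated (k \<union> S))"
proof -
  define L0 where "L0 = fixed_field H"
  have HA: "H \<subseteq> Aut k" using H by (simp add: is_subgroup_def)
  have L0: "subfield L0" "k \<subseteq> L0" "alg_dense L0" "Aut L0 = H"
    using subfield_fixed_field[OF HA] fixed_field_superset[OF HA]
      alg_dense_fixed_field_compact[OF H comp] Aut_fixed_field_compact[OF H comp] by (auto simp: L0_def)
  obtain W where W: "openin pointwise_topology W" "H = W \<inter> Aut k"
    using op unfolding Gal_top_def openin_subtopology by blast
  have "id \<in> W" using H W by (auto simp: is_subgroup_def)
  then obtain S where S: "finite S" "\<And>\<tau>. (\<forall>s\<in>S. \<tau> s = s) \<Longrightarrow> \<tau> \<in> W"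
    using W(1) unfolding openin_pointwise_topology by (metis id_apply)
  define K where "K = field_generated (k \<union> S)"
  have K: "subfield K" unfolding K_def by (rule subfield_field_generated)
  have "Aut K \<subseteq> H" unfolding K_def Aut_field_generated using S(2) W(2) by blast
  \<comment> \<open>\<open>Aut K\<close> lies in \<open>H\<close>, so what \<open>H\<close> fixes is
    purely inseparable over \<open>K\<close>; as \<open>F\<close> is algebraic over
    \<open>L0\<close>, it is algebraic over \<open>K\<close>.\<close>
  hence "L0 \<subseteq> fixed_field (Aut K)" unfolding L0_def fixed_field_def by blast
  hence "L0 \<subseteq> perfect_closure K" unfolding fixed_field_Aut[OF closed K] .
  hence K_dense: "algebraic_over K z" for z
    using L0(3) algebraic_over_mono algebraic_over_perfect_closure[OF K] unfolding alg_dense_def by blast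
  define P where "P s = (\<Prod>\<eta>\<in>(\<lambda>\<sigma>. \<sigma> s) ` H. [:- \<eta>, 1:])" for s
  have P: "P s \<in> poly_over L0" "poly (P s) s = 0" "P s \<noteq> 0" for s
    using orbit_polynomial_over_fixed_field[OF H finite_orbit_if_compact, of s] comp
    unfolding P_def L0_def compactin_Gal_top by simp_all
  define C where "C = (\<Union>s\<in>S. range (coeff (P s)))"
  have "finite (range (coeff p))" for p :: "'a poly"
  proof -
    have "coeff p i \<in> insert 0 (coeff p ` {..degree p})" for i
      by (cases "i \<le> degree p") (auto simp: coeff_eq_0)
    hence "range (coeff p) \<subseteq> insert 0 (coeff p ` {..degree p})" by blast
    thus ?thesis by (rule finite_subset) auto
  qed
  hence C: "finite C" "C \<subseteq> L0" using S(1) P(1) by (auto simp: C_def poly_over_def)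
  define L1 where "L1 = field_generated (k \<union> C)"
  have L1: "subfield L1" "k \<union> C \<subseteq> L1"
    unfolding L1_def by (rule subfield_field_generated, rule field_generated_superset)
  have "algebraic_over L1 s" if "s \<in> S" for s
  proof -
    have "P s \<in> poly_over L1" using that L1(2) unfolding poly_over_def C_def by blast
    thus ?thesis using P unfolding algebraic_over_iff by blast
  qed
  \<comment> \<open>\<open>F\<close> is algebraic over \<open>K\<close>, hence over
    \<open>L1(S)\<close>, and the elements of \<open>S\<close> are algebraic over
    \<open>L1\<close>.\<close>
  moreover have "K \<subseteq> field_generated (L1 \<union> S)"
    unfolding K_def using L1 field_generated_superset[of "L1 \<union> S"]
    by (intro field_generated_least subfield_field_generated) auto
  hence "algebraic_over (field_generated (L1 \<union> S)) z" for z using K_dense algebraic_over_mono by blast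
  ultimately have L1_dense: "alg_dense L1"
    unfolding alg_dense_def using algebraic_over_field_generated_trans[OF L1(1) S(1)] by blast
  have "compactin (Gal_top k) (Aut L1)" using compactin_Aut_if_alg_dense[OF L1_dense] L1(2) by blast
  moreover have "closedin pointwise_topology (- W)"
    using W(1) by (simp add: closedin_def PiE_UNIV_domain)
  \<comment> \<open>This set is \<open>Aut L1 - H\<close>, a closed part of the compact group
    \<open>Aut L1\<close>.\<close>
  ultimately have comp1: "compactin pointwise_topology (Aut L1 \<inter> - W)"
    unfolding compactin_Gal_top using compact_Int_closedin by blast
  define V where "V l = {\<sigma> :: 'a \<Rightarrow> 'a. \<sigma> l \<noteq> l}" for l
  have "openin pointwise_topology (V l)" for l
    unfolding openin_pointwise_topology V_def by (auto intro!: exI[of _ "{l}"])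
  moreover have "Aut L1 \<inter> - W \<subseteq> \<Union>(V ` L0)"
  proof
    fix \<sigma> assume \<sigma>: "\<sigma> \<in> Aut L1 \<inter> - W"
    hence "\<sigma> \<notin> Aut L0" using L0(4) W(2) by blast
    thus "\<sigma> \<in> \<Union>(V ` L0)" using \<sigma> by (auto simp: Aut_iff V_def)
  qed
  ultimately obtain \<F> where "finite \<F>" "\<F> \<subseteq> V ` L0" "Aut L1 \<inter> - W \<subseteq> \<Union>\<F>"
    using compactinD[OF comp1, of "V ` L0"] by blast
  then obtain D where D: "D \<subseteq> L0" "finite D" "Aut L1 \<inter> - W \<subseteq> \<Union>(V ` D)"
    using finite_subset_image by metis
  \<comment> \<open>\<open>C\<close> makes \<open>F\<close> algebraic over \<open>L\<close>, and
    \<open>D\<close> excludes the automorphisms over \<open>L1\<close> outside \<open>H\<close>.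
    Both lie in \<open>L0\<close>, so \<open>H\<close> fixes \<open>L\<close>.\<close>
  define L where "L = field_generated (k \<union> (C \<union> D))"
  have "L1 \<subseteq> L"
    unfolding L1_def L_def using field_generated_superset[of "k \<union> (C \<union> D)"]
    by (intro field_generated_least subfield_field_generated) blast
  hence "alg_dense L" using L1_dense alg_dense_mono by blast
  moreover have "H \<subseteq> Aut L"
  proof -
    have "L \<subseteq> L0" unfolding L_def using L0 C D by (intro field_generated_least) auto
    thus ?thesis using Aut_antimono L0(4) by blast
  qed
  moreover have "Aut L \<subseteq> H"
  proof
    fix \<sigma> assume \<sigma>: "\<sigma> \<in> Aut L"
    hence "\<sigma> \<notin> \<Union>(V ` D)" unfolding L_def Aut_field_generated V_def by auto
    moreover have "\<sigma> \<in> Aut L1" "\<sigma> \<in> Aut k"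
      using \<sigma> Aut_antimono[OF \<open>L1 \<subseteq> L\<close>] Aut_field_generated[of k "C \<union> D"] unfolding L_def by blast+
    ultimately show "\<sigma> \<in> H" using D(3) W(2) by blast
  qed
  ultimately show ?thesis using C D unfolding L_def by (intro exI[of _ "C \<union> D"]) auto
qed

text \<open>The bijections in (2) and (3) are split up: the criterion for
  \<open>Aut L1 = Aut L2\<close> gives injectivity up to perfect equivalence, and the existence
  clauses give surjectivity.\<close>

theorem mainTheorem7:
  fixes k :: "'a::field set"
  assumes "alg_closed_field TYPE('a)"
    and "subfield k"
  shows
    "(\<forall>L. subfield L \<and> k \<subseteq> L \<longrightarrow>
        is_subgroup (Aut L) (Aut k) \<and> closedin (Gal_top k) (Aut L))
   \<and> (\<forall>L1 L2. subfield L1 \<and> k \<subseteq> L1 \<and> subfield L2 \<and> k \<subseteq> L2 \<longrightarrow>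
        (Aut L1 = Aut L2 \<longleftrightarrow> perfect_closure L1 = perfect_closure L2))
   \<and> (\<forall>L. subfield L \<and> k \<subseteq> L \<and> alg_dense L \<longrightarrow> compactin (Gal_top k) (Aut L))
   \<and> (\<forall>H. is_subgroup H (Aut k) \<and> compactin (Gal_top k) H \<longrightarrow>
        (\<exists>L. subfield L \<and> k \<subseteq> L \<and> alg_dense L \<and> H = Aut L))
   \<and> (\<forall>L. subfield L \<and> k \<subseteq> L \<and> fin_gen_over k L \<and> alg_dense L \<longrightarrow>
        compactin (Gal_top k) (Aut L) \<and> openin (Gal_top k) (Aut L))
   \<and> (\<forall>H. is_subgroup H (Aut k) \<and> compactin (Gal_top k) H \<and> openin (Gal_top k) H \<longrightarrow>
        (\<exists>L. subfield L \<and> k \<subseteq> L \<and> fin_gen_over k L \<and> alg_dense L \<and> H = Aut L))"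
proof (intro conjI allI impI; (elim conjE)?)
  fix L :: "'a set" assume "subfield L" "k \<subseteq> L"
  show "is_subgroup (Aut L) (Aut k)" using is_subgroup_Aut[OF \<open>k \<subseteq> L\<close>] .
  show "closedin (Gal_top k) (Aut L)" using closedin_Aut[OF \<open>k \<subseteq> L\<close>] .
next
  fix L1 L2 :: "'a set" assume "subfield L1" "subfield L2"
  thus "Aut L1 = Aut L2 \<longleftrightarrow> perfect_closure L1 = perfect_closure L2"
    using Aut_eq_iff_perfect_closure_eq[OF assms(1)] by blast
next
  fix L :: "'a set" assume "k \<subseteq> L" "alg_dense L"
  thus "compactin (Gal_top k) (Aut L)" using compactin_Aut_if_alg_dense by blast
  \<comment> \<open>The same fact answers the clause on finitely generated fields.\<close>
  thus "compactin (Gal_top k) (Aut L)" .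
next
  fix H :: "('a \<Rightarrow> 'a) set" assume H: "is_subgroup H (Aut k)" "compactin (Gal_top k) H"
  have "H \<subseteq> Aut k" using H by (simp add: is_subgroup_def)
  thus "\<exists>L. subfield L \<and> k \<subseteq> L \<and> alg_dense L \<and> H = Aut L"
    using subfield_fixed_field[of H k] fixed_field_superset[of H k] alg_dense_fixed_field_compact[OF H]
      Aut_fixed_field_compact[OF H] by (intro exI[of _ "fixed_field H"]) simp
next
  fix L :: "'a set" assume "fin_gen_over k L"
  thus "openin (Gal_top k) (Aut L)" by (rule openin_Aut_if_fin_gen)
next
  fix H :: "('a \<Rightarrow> 'a) set" assume "is_subgroup H (Aut k)" "compactin (Gal_top k) H" "openin (Gal_top k) H"
  from compact_open_subgroup_fin_gen[OF assms(1) this] obtain S where S: "finite S"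
    "alg_dense (field_generated (k \<union> S))" "H = Aut (field_generated (k \<union> S))" by blast
  thus "\<exists>L. subfield L \<and> k \<subseteq> L \<and> fin_gen_over k L \<and> alg_dense L \<and> H = Aut L"
    using subfield_field_generated[of "k \<union> S"] field_generated_superset[of "k \<union> S"]
    unfolding fin_gen_over_def by blast
qed

end
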